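(* The class of planar graphs is not $\mathrm{CFOL}$-definable on ordered graphs.
   Context: Graphs are finite simple undirected graphs $G=(V,E)$. $\mathrm{CFOL}$ is first-order logic extended by the modular counting quantifiers $\mathrm{D}_{m,i}x\,\phi(x)$, expressing that the number of elements $x$ satisfying $\phi$ is congruent to $i$ modulo $m$. A class $\mathcal{C}$ of graphs is $\mathrm{CFOL}$-definable on ordered graphs if there is a $\mathrm{CFOL}$-sentence $\varphi$ over the vocabulary $\{E,<\}$ such that for every finite graph $G$ and every linear order $<$ on $V(G)$: $(V(G),E(G),<)\models\varphi$ iff $G\in\mathcal{C}$. *)

theory Defs
  imports "HOL-Analysis.Analysis" "HOL-Number_Theory.Cong" "Graph_Theory.Pair_Digraph"
begin

text \<open>
  Finite simple undirected graphs are the finite, symmetric, loop-free pair digraphs, i.e. the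
  locale predicate \<^const>\<open>pair_graph\<close>; the edge relation is \<^const>\<open>parcs\<close>.
\<close>

datatype cfol =
    Eq nat nat
  | Adj nat nat
  | Less nat nat
  | Neg cfol
  | Conj cfol cfol
  | Exists nat cfol
  | ModEx nat nat nat cfol  \<comment> \<open>\<open>ModEx m i x \<phi>\<close> is \<open>D\<^bsub>m,i\<^esub> x. \<phi>\<close>\<close>

primrec fv :: "cfol \<Rightarrow> nat set" where
  "fv (Eq x y) = {x, y}"
| "fv (Adj x y) = {x, y}"
| "fv (Less x y) = {x, y}"
| "fv (Neg \<phi>) = fv \<phi>"
| "fv (Conj \<phi> \<psi>) = fv \<phi> \<union> fv \<psi>"
| "fv (Exists x \<phi>) = fv \<phi> - {x}"
| "fv (ModEx m i x \<phi>) = fv \<phi> - {x}"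

text \<open>Moduli have to be positive: congruence modulo \<open>0\<close> would be equality.\<close>

primrec pos_moduli :: "cfol \<Rightarrow> bool" where
  "pos_moduli (Eq x y) \<longleftrightarrow> True"
| "pos_moduli (Adj x y) \<longleftrightarrow> True"
| "pos_moduli (Less x y) \<longleftrightarrow> True"
| "pos_moduli (Neg \<phi>) \<longleftrightarrow> pos_moduli \<phi>"
| "pos_moduli (Conj \<phi> \<psi>) \<longleftrightarrow> pos_moduli \<phi> \<and> pos_moduli \<psi>"
| "pos_moduli (Exists x \<phi>) \<longleftrightarrow> pos_moduli \<phi>"
| "pos_moduli (ModEx m i x \<phi>) \<longleftrightarrow> 0 < m \<and> pos_moduli \<phi>"

definition cfol_sentence :: "cfol \<Rightarrow> bool" where
  "cfol_sentence \<phi> \<longleftrightarrow> pos_moduli \<phi> \<and> fv \<phi> = {}"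

primrec sat :: "'a pair_pre_digraph \<Rightarrow> 'a rel \<Rightarrow> (nat \<Rightarrow> 'a) \<Rightarrow> cfol \<Rightarrow> bool" where
  "sat G L s (Eq x y) \<longleftrightarrow> s x = s y"
| "sat G L s (Adj x y) \<longleftrightarrow> (s x, s y) \<in> parcs G"
| "sat G L s (Less x y) \<longleftrightarrow> (s x, s y) \<in> L"
| "sat G L s (Neg \<phi>) \<longleftrightarrow> \<not> sat G L s \<phi>"
| "sat G L s (Conj \<phi> \<psi>) \<longleftrightarrow> sat G L s \<phi> \<and> sat G L s \<psi>"
| "sat G L s (Exists x \<phi>) \<longleftrightarrow> (\<exists>a \<in> pverts G. sat G L (s(x := a)) \<phi>)"
| "sat G L s (ModEx m i x \<phi>) \<longleftrightarrow> [card {a \<in> pverts G. sat G L (s(x := a)) \<phi>} = i] (mod m)"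

lemma sat_cong_fv:
  assumes "\<And>x. x \<in> fv \<phi> \<Longrightarrow> s x = t x"
  shows "sat G L s \<phi> \<longleftrightarrow> sat G L t \<phi>"
  using assms
proof (induction \<phi> arbitrary: s t)
  case (Exists x \<phi>)
  have "sat G L (s(x := a)) \<phi> \<longleftrightarrow> sat G L (t(x := a)) \<phi>" for a
    by (rule Exists.IH) (use Exists.prems in auto)
  then show ?case by simp
next
  case (ModEx m i x \<phi>)
  have "sat G L (s(x := a)) \<phi> \<longleftrightarrow> sat G L (t(x := a)) \<phi>" for a
    by (rule ModEx.IH) (use ModEx.prems in auto)
  then show ?case by simp
next
  case (Neg \<phi>)
  have "sat G L s \<phi> \<longleftrightarrow> sat G L t \<phi>"
    by (rule Neg.IH) (use Neg.prems in auto)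
  then show ?case by simp
next
  case (Conj \<phi> \<psi>)
  have "sat G L s \<phi> \<longleftrightarrow> sat G L t \<phi>" "sat G L s \<psi> \<longleftrightarrow> sat G L t \<psi>"
    by (rule Conj.IH; use Conj.prems in auto)+
  then show ?case by simp
qed auto

text \<open>
  Only used for sentences, whose truth value does not depend on the assignment by
  \<open>sat_cong_fv\<close>; the assignments are not confined to the vertex set so that the empty
  graph needs no special treatment.
\<close>

definition models :: "'a pair_pre_digraph \<Rightarrow> 'a rel \<Rightarrow> cfol \<Rightarrow> bool" where
  "models G L \<phi> \<longleftrightarrow> (\<forall>s. sat G L s \<phi>)"

definition cfol_definable_on_ordered_graphs :: "'a pair_pre_digraph set \<Rightarrow> bool" where
  "cfol_definable_on_ordered_graphs \<C> \<longleftrightarrow>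
     (\<exists>\<phi>. cfol_sentence \<phi> \<and>
       (\<forall>G L. pair_graph G \<longrightarrow> L \<subseteq> pverts G \<times> pverts G \<longrightarrow>
          strict_linear_order_on (pverts G) L \<longrightarrow> (models G L \<phi> \<longleftrightarrow> G \<in> \<C>)))"

definition uedges :: "'a pair_pre_digraph \<Rightarrow> 'a set set" where
  "uedges G = {{u, v} | u v. (u, v) \<in> parcs G}"

definition plane_drawing ::
    "'a pair_pre_digraph \<Rightarrow> ('a \<Rightarrow> complex) \<Rightarrow> ('a set \<Rightarrow> real \<Rightarrow> complex) \<Rightarrow> bool" where
  "plane_drawing G p c \<longleftrightarrow>
     inj_on p (pverts G) \<and>
     (\<forall>e \<in> uedges G. arc (c e) \<and> {pathstart (c e), pathfinish (c e)} = p ` e \<and>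
        path_image (c e) \<inter> p ` pverts G = p ` e) \<and>
     (\<forall>e \<in> uedges G. \<forall>f \<in> uedges G. e \<noteq> f \<longrightarrow>
        path_image (c e) \<inter> path_image (c f) = p ` (e \<inter> f))"

definition planar :: "'a pair_pre_digraph \<Rightarrow> bool" where
  "planar G \<longleftrightarrow> (\<exists>p c. plane_drawing G p c)"

text \<open>
  Every finite graph is isomorphic to one whose vertices are natural numbers, so \<open>nat\<close> serves
  as the universe of vertices.
\<close>

definition planar_graphs :: "nat pair_pre_digraph set" where
  "planar_graphs = {G. pair_graph G \<and> planar G}"

end

theory Submission
  imports Defs
begin

text \<open>
  A word of permutations of five tracks is turned into an ordered graph: five parallel tracks, permuted
  from column to column by the letters, whose first and last columns are joined to paths. If the letters
  multiply to the identity, the graph is part of a grid and hence planar; if they multiply to the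
  three-cycle \<open>1 \<mapsto> 3 \<mapsto> 4 \<mapsto> 1\<close>, it contains a subdivided \<open>K\<^sub>3\<^sub>,\<^sub>3\<close>. A subdivided
  \<open>K\<^sub>3\<^sub>,\<^sub>3\<close> is not planar: by the Jordan curve theorem and Janiszewski's theorem no connected set off a
  theta curve can touch the interiors of all of its three arcs.

  A sentence of quantifier depth \<open>r\<close> cannot distinguish words that agree in the numbers of positions, up to
  congruence and vanishing, whose marking leads to a given equivalence class of depth \<open>r - 1\<close>. This
  equivalence is a congruence of finite index, so some power of each word is idempotent. As every
  three-cycle of five points is a commutator \<open>x y x\<inverse> y\<inverse>\<close> of three-cycles, induction on the depth yields
  equivalent words with products the three-cycle and \<open>1\<close>: if \<open>p\<close>, \<open>q\<close> are blocks with products \<open>x\<close>, \<open>y\<close>, both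
  equivalent to an idempotent \<open>e\<close> at depth \<open>r\<close>, then \<open>e p q p p q q e\<close> and \<open>e p p p q q q e\<close> are equivalent at
  depth \<open>r + 1\<close>, since all inner blocks see the same contexts.
\<close>

subsection \<open>Counting equivalence of words\<close>

primrec pairs :: "'a list \<Rightarrow> ('a \<times> 'a) set" where
  "pairs [] = {}"
| "pairs (a # w) = {a} \<times> set w \<union> pairs w"

primrec steps :: "'a list \<Rightarrow> ('a \<times> 'a) set" where
  "steps [] = {}"
| "steps (a # w) = {a} \<times> set (take 1 w) \<union> steps w"

lemma pairs_append: "pairs (u @ v) = pairs u \<union> pairs v \<union> set u \<times> set v"
  by (induction u) auto

lemma set_take1_append: "set (take 1 (u @ v)) = (if u = [] then set (take 1 v) else set (take 1 u))"
  by (cases u) auto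

lemma steps_append: "steps (u @ v) = steps u \<union> steps v \<union> set (take 1 (rev u)) \<times> set (take 1 v)"
proof (induction u)
  case (Cons a u)
  then show ?case
    by (cases "u = []") (simp_all add: set_take1_append Un_ac del: One_nat_def take_append)
qed simp

lemma pairs_eq: "pairs w = {(w ! i, w ! j) | i j. i < j \<and> j < length w}"
proof (induction w)
  case (Cons a w)
  show ?case
  proof (intro equalityI subsetI)
    fix z assume "z \<in> pairs (a # w)"
    then consider j where "z = (a, w ! j)" "j < length w"
      | i j where "z = (w ! i, w ! j)" "i < j" "j < length w"
      using Cons by (auto simp: in_set_conv_nth)
    then show "z \<in> {((a # w) ! i, (a # w) ! j) |i j. i < j \<and> j < length (a # w)}"
    proof cases
      case 1
      then have "z = ((a # w) ! 0, (a # w) ! Suc j) \<and> 0 < Suc j \<and> Suc j < length (a # w)"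
        by simp
      then show ?thesis by blast
    next
      case 2
      then have "z = ((a # w) ! Suc i, (a # w) ! Suc j) \<and> Suc i < Suc j \<and> Suc j < length (a # w)"
        by simp
      then show ?thesis by blast
    qed
  next
    fix z assume "z \<in> {((a # w) ! i, (a # w) ! j) |i j. i < j \<and> j < length (a # w)}"
    then obtain i j where "z = ((a # w) ! i, (a # w) ! j)" "i < j" "j < length (a # w)" by blast
    then show "z \<in> pairs (a # w)"
      using Cons by (cases i; cases j) auto
  qed
qed simp

lemma steps_eq: "steps w = {(w ! i, w ! Suc i) | i. Suc i < length w}"
proof (induction w)
  case (Cons a w)
  show ?case
  proof (intro equalityI subsetI)
    fix z assume "z \<in> steps (a # w)"
    then consider "z = (a, w ! 0)" "w \<noteq> []"
      | i where "z = (w ! i, w ! Suc i)" "Suc i < length w"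
      using Cons by (cases w) auto
    then show "z \<in> {((a # w) ! i, (a # w) ! Suc i) |i. Suc i < length (a # w)}"
    proof cases
      case 1
      then have "z = ((a # w) ! 0, (a # w) ! Suc 0) \<and> Suc 0 < length (a # w)"
        by simp
      then show ?thesis by blast
    next
      case 2
      then have "z = ((a # w) ! Suc i, (a # w) ! Suc (Suc i)) \<and> Suc (Suc i) < length (a # w)"
        by simp
      then show ?thesis by blast
    qed
  next
    fix z assume "z \<in> {((a # w) ! i, (a # w) ! Suc i) |i. Suc i < length (a # w)}"
    then obtain i where "z = ((a # w) ! i, (a # w) ! Suc i)" "Suc i < length (a # w)" by blast
    then show "z \<in> steps (a # w)"
      using Cons by (cases i; cases w) auto
  qed
qed simp

text \<open>Depth 0 of the equivalence: \<open>set\<close>, \<open>steps\<close> and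
  \<open>pairs\<close> decide the atomic formulas about marked vertices, and the first and last
  letters make the code of a concatenation computable from the codes of its factors.\<close>

definition word_code :: "'a list \<Rightarrow> 'a list \<times> 'a list \<times> 'a set \<times> ('a \<times> 'a) set \<times> ('a \<times> 'a) set" where
  "word_code w = (take 1 w, take 1 (rev w), set w, steps w, pairs w)"

lemma word_code_append_cong:
  assumes "word_code u = word_code u'" "word_code v = word_code v'"
  shows "word_code (u @ v) = word_code (u' @ v')"
proof -
  have "u = [] \<longleftrightarrow> u' = []" "v = [] \<longleftrightarrow> v' = []"
    using assms by (auto simp: word_code_def)
  moreover have "take 1 (x @ y) = (if x = [] then take 1 y else take 1 x)" for x y :: "'a list"
    by (cases x) auto
  ultimately show ?thesis
    using assms unfolding word_code_def steps_append pairs_append set_append rev_append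
    by (simp del: One_nat_def take_append)
qed

lemma finite_word_code:
  assumes "finite A"
  shows "finite (word_code ` lists A)"
proof -
  have *: "pairs w \<subseteq> A \<times> A" "steps w \<subseteq> A \<times> A" if "set w \<subseteq> A" for w
    using that nth_mem unfolding pairs_eq steps_eq by fastforce+
  let ?L = "{xs. set xs \<subseteq> A \<and> length xs \<le> 1}"
  have "word_code ` lists A \<subseteq> ?L \<times> ?L \<times> Pow A \<times> Pow (A \<times> A) \<times> Pow (A \<times> A)"
    using * unfolding word_code_def lists_eq_set
    by (auto dest!: in_set_takeD)
  moreover have "finite \<dots>"
    using assms finite_lists_length_le by (intro finite_cartesian_product) auto
  ultimately show ?thesis by (rule finite_subset)
qed

section \<open>Equivalence under modular counting of marked positions\<close>

definition hits :: "('a \<Rightarrow> 'a) \<Rightarrow> ('a list \<Rightarrow> bool) \<Rightarrow> 'a list \<Rightarrow> nat" where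
  "hits f P u = card {q. q < length u \<and> P (u[q := f (u ! q)])}"

text \<open>Congruence modulo \<open>M\<close> serves the quantifiers \<open>ModEx\<close> whose
  modulus divides \<open>M\<close>; agreement about 0 serves \<open>Exists\<close>.\<close>

definition agree :: "nat \<Rightarrow> nat \<Rightarrow> nat \<Rightarrow> bool" where
  "agree M a b \<longleftrightarrow> [a = b] (mod M) \<and> (a = 0 \<longleftrightarrow> b = 0)"

text \<open>An Ehrenfeucht-Fraisse equivalence with counting: \<open>f\<close> places a mark, and
  \<open>P\<close> ranges over the unions of classes one level lower. Writing these unions as
  invariant predicates keeps quotients out of the recursion.\<close>

primrec eqv :: "nat \<Rightarrow> ('a \<Rightarrow> 'a) set \<Rightarrow> nat \<Rightarrow> 'a list \<Rightarrow> 'a list \<Rightarrow> bool" where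
  "eqv M F 0 u v \<longleftrightarrow> word_code u = word_code v"
| "eqv M F (Suc r) u v \<longleftrightarrow> eqv M F r u v \<and>
     (\<forall>f\<in>F. \<forall>P. (\<forall>x y. eqv M F r x y \<longrightarrow> P x = P y) \<longrightarrow> agree M (hits f P u) (hits f P v))"

lemma agree_refl: "agree M a a"
  and agree_sym: "agree M a b \<Longrightarrow> agree M b a"
  and agree_trans: "agree M a b \<Longrightarrow> agree M b c \<Longrightarrow> agree M a c"
  and agree_add: "agree M a b \<Longrightarrow> agree M c d \<Longrightarrow> agree M (a + c) (b + d)"
  by (auto simp: agree_def cong_sym_eq intro: cong_trans cong_add)

lemma eqv_refl: "eqv M F r u u"
  by (induction r) (auto simp: agree_refl)

lemma eqv_sym: "eqv M F r u v \<Longrightarrow> eqv M F r v u"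
  by (induction r) (auto intro: agree_sym)

lemma eqv_trans: "eqv M F r u v \<Longrightarrow> eqv M F r v w \<Longrightarrow> eqv M F r u w"
proof (induction r)
  case (Suc r)
  then have "agree M (hits f P u) (hits f P w)"
    if "f \<in> F" "\<forall>x y. eqv M F r x y \<longrightarrow> P x = P y" for f P
    using agree_trans[of M "hits f P u" "hits f P v" "hits f P w"] that by simp
  then show ?case using Suc by simp
qed simp

lemma eqv_mono: "eqv M F r u v \<Longrightarrow> r' \<le> r \<Longrightarrow> eqv M F r' u v"
  by (induction r) (auto simp: le_Suc_eq)

text \<open>The marked position lies in one factor, and the other factor becomes a fixed context of
  \<open>P\<close>.\<close>

lemma hits_append:
  "hits f P (u @ v) = hits f (\<lambda>x. P (x @ v)) u + hits f (\<lambda>x. P (u @ x)) v"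
proof -
  let ?A = "{q. q < length u \<and> P (u[q := f (u ! q)] @ v)}"
  let ?B = "{q. q < length v \<and> P (u @ v[q := f (v ! q)])}"
  have "{q. q < length (u @ v) \<and> P ((u @ v)[q := f ((u @ v) ! q)])} = ?A \<union> (\<lambda>q. length u + q) ` ?B"
    (is "?L = ?R")
  proof (intro equalityI subsetI)
    fix q assume q: "q \<in> ?L"
    show "q \<in> ?R"
    proof (cases "q < length u")
      case True
      with q show ?thesis by (auto simp: list_update_append nth_append)
    next
      case False
      then have "q = length u + (q - length u)" "q - length u \<in> ?B"
        using q by (auto simp: list_update_append nth_append)
      then show ?thesis by blast
    qed
  qed (auto simp: list_update_append nth_append)
  moreover have "card (?A \<union> (\<lambda>q. length u + q) ` ?B) = card ?A + card ((\<lambda>q. length u + q) ` ?B)"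
    by (rule card_Un_disjoint) auto
  moreover have "card ((\<lambda>q. length u + q) ` ?B) = card ?B"
    by (rule card_image) auto
  ultimately show ?thesis by (simp add: hits_def)
qed

text \<open>By the induction hypothesis an invariant predicate stays invariant when read in a fixed
  context, and equivalent contexts yield the same predicate; so the hits can be compared factor by
  factor.\<close>

lemma eqv_append:
  "eqv M F r u u' \<Longrightarrow> eqv M F r v v' \<Longrightarrow> eqv M F r (u @ v) (u' @ v')"
proof (induction r arbitrary: u u' v v')
  case 0
  then show ?case using word_code_append_cong by auto
next
  case (Suc r)
  have "agree M (hits f P (u @ v)) (hits f P (u' @ v'))"
    if f: "f \<in> F" and P: "\<forall>x y. eqv M F r x y \<longrightarrow> P x = P y" for f P
  proof -
    have "(\<lambda>x. P (x @ v)) = (\<lambda>x. P (x @ v'))"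
      using P Suc.IH[OF eqv_refl] Suc.prems(2) by (metis eqv.simps(2))
    moreover have "(\<lambda>x. P (u @ x)) = (\<lambda>x. P (u' @ x))"
      using P Suc.IH[OF _ eqv_refl] Suc.prems(1) by (metis eqv.simps(2))
    moreover have "agree M (hits f (\<lambda>x. P (x @ v)) u) (hits f (\<lambda>x. P (x @ v)) u')"
      using Suc.prems(1) f P Suc.IH[OF _ eqv_refl] by auto
    moreover have "agree M (hits f (\<lambda>x. P (u @ x)) v) (hits f (\<lambda>x. P (u @ x)) v')"
      using Suc.prems(2) f P Suc.IH[OF eqv_refl] by auto
    ultimately show ?thesis
      unfolding hits_append by (metis agree_add)
  qed
  then show ?case using Suc by simp
qed

text \<open>Induction on the depth: the new code consists of the old one and, for each marking and
  each set of old codes, the residue modulo \<open>M\<close> and the vanishing of a count. Codes may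
  be finer than the classes.\<close>

lemma eqv_finite_index:
  assumes "0 < M" "finite F" "finite A" and closed: "\<And>f a. f \<in> F \<Longrightarrow> a \<in> A \<Longrightarrow> f a \<in> A"
  shows "\<exists>c :: 'a list \<Rightarrow> nat. finite (c ` lists A) \<and>
    (\<forall>u\<in>lists A. \<forall>v\<in>lists A. c u = c v \<longrightarrow> eqv M F r u v)"
proof (induction r)
  case 0
  have fin: "finite (word_code ` lists A)" by (rule finite_word_code) fact
  then obtain h :: "_ \<Rightarrow> nat" where "inj_on h (word_code ` lists A)"
    using finite_imp_inj_to_nat_seg by blast
  then have "\<forall>u\<in>lists A. \<forall>v\<in>lists A. h (word_code u) = h (word_code v) \<longrightarrow> eqv M F 0 u v"
    by (simp add: inj_on_def)
  moreover have "finite ((\<lambda>u. h (word_code u)) ` lists A)"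
    using finite_imageI[OF fin, of h] by (simp add: image_image)
  ultimately show ?case by blast
next
  case (Suc r)
  then obtain c :: "'a list \<Rightarrow> nat" where c: "finite (c ` lists A)"
    "\<And>u v. u \<in> lists A \<Longrightarrow> v \<in> lists A \<Longrightarrow> c u = c v \<Longrightarrow> eqv M F r u v" by blast
  define D where "D = F \<times> Pow (c ` lists A)"
  define g where "g u = (c u, \<lambda>d\<in>D. (hits (fst d) (\<lambda>x. c x \<in> snd d) u mod M,
      hits (fst d) (\<lambda>x. c x \<in> snd d) u = 0))" for u
  have "g ` lists A \<subseteq> c ` lists A \<times> (D \<rightarrow>\<^sub>E {..<M} \<times> UNIV)"
    using \<open>0 < M\<close> by (auto simp: g_def)
  moreover have "finite \<dots>"
    using c(1) \<open>finite F\<close> by (auto simp: D_def intro!: finite_cartesian_product finite_PiE)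
  ultimately have fin: "finite (g ` lists A)" by (rule finite_subset)
  have "eqv M F (Suc r) u v" if u: "u \<in> lists A" and v: "v \<in> lists A" and g: "g u = g v" for u v
  proof -
    have "agree M (hits f P u) (hits f P v)"
      if f: "f \<in> F" and P: "\<forall>x y. eqv M F r x y \<longrightarrow> P x = P y" for f P
    proof -
      \<comment> \<open>The invariant predicate \<open>P\<close> is replaced by the set of codes
        that satisfy it; closure of \<open>A\<close> under \<open>F\<close> keeps marked words in
        the domain of the codes.\<close>
      define S where "S = c ` {x \<in> lists A. P x}"
      have S: "c x \<in> S \<longleftrightarrow> P x" if "x \<in> lists A" for x
        using that c(2) P unfolding S_def by blast
      have h: "hits f P w = hits f (\<lambda>x. c x \<in> S) w" if w: "w \<in> lists A" for w
      proof -
        have "w[q := f (w ! q)] \<in> lists A" if "q < length w" for q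
          using w closed[OF f] nth_mem[OF that] set_update_subsetI[of w A "f (w ! q)" q]
          by (auto simp: lists_eq_set)
        then show ?thesis unfolding hits_def using S by (metis (no_types, lifting))
      qed
      have "(f, S) \<in> D" using f by (auto simp: D_def S_def)
      then have "hits f (\<lambda>x. c x \<in> S) u mod M = hits f (\<lambda>x. c x \<in> S) v mod M \<and>
          (hits f (\<lambda>x. c x \<in> S) u = 0) = (hits f (\<lambda>x. c x \<in> S) v = 0)"
        using g unfolding g_def by (auto dest!: fun_cong[of _ _ "(f, S)"])
      then show ?thesis using h u v by (simp add: agree_def cong_def)
    qed
    moreover have "eqv M F r u v" using g c(2) u v by (simp add: g_def)
    ultimately show ?thesis by simp
  qed
  moreover obtain h :: "_ \<Rightarrow> nat" where "inj_on h (g ` lists A)"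
    using fin finite_imp_inj_to_nat_seg by blast
  ultimately have "\<forall>u\<in>lists A. \<forall>v\<in>lists A. h (g u) = h (g v) \<longrightarrow> eqv M F (Suc r) u v"
    unfolding inj_on_def by blast
  moreover have "finite ((\<lambda>u. h (g u)) ` lists A)"
    using finite_imageI[OF fin, of h] by (simp add: image_image)
  ultimately show ?case by blast
qed

section \<open>Idempotent powers and permuted blocks\<close>

abbreviation wpow :: "'a list \<Rightarrow> nat \<Rightarrow> 'a list" where
  "wpow w n \<equiv> concat (replicate n w)"

lemma wpow_add: "wpow w (m + n) = wpow w m @ wpow w n"
  by (simp add: replicate_add)

text \<open>Finite index puts two powers with exponents \<open>i < j\<close> into one class, so from
  exponent \<open>i\<close> on the powers are periodic with period \<open>j - i\<close>.\<close>

lemma eqv_idempotent_power: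
  assumes "0 < M" "finite F" "finite A" "\<And>f a. f \<in> F \<Longrightarrow> a \<in> A \<Longrightarrow> f a \<in> A" "w \<in> lists A"
  shows "\<exists>n>0. eqv M F r (wpow w n @ wpow w n) (wpow w n)"
proof -
  obtain c :: "'a list \<Rightarrow> nat" where c: "finite (c ` lists A)"
    "\<And>u v. u \<in> lists A \<Longrightarrow> v \<in> lists A \<Longrightarrow> c u = c v \<Longrightarrow> eqv M F r u v"
    using eqv_finite_index[of M F A r] assms(1-4) by blast
  have w: "wpow w n \<in> lists A" for n
    using assms(5) by (induction n) auto
  have "finite ((\<lambda>n. c (wpow w n)) ` {1..})"
    by (rule finite_subset[OF _ c(1)]) (use w in auto)
  then have "\<not> inj_on (\<lambda>n. c (wpow w n)) {1..}"
    using finite_imageD infinite_Ici by blast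
  then obtain i j where ij: "1 \<le> i" "i < j" "c (wpow w i) = c (wpow w j)"
    unfolding inj_on_def by (metis atLeast_iff linorder_neqE_nat)
  define d where "d = j - i"
  have d: "d > 0" "j = i + d" using ij by (auto simp: d_def)
  have step: "eqv M F r (wpow w (m + d)) (wpow w m)" if "i \<le> m" for m
  proof -
    have "eqv M F r (wpow w j @ wpow w (m - i)) (wpow w i @ wpow w (m - i))"
      using c(2)[OF w w ij(3)[symmetric]] by (intro eqv_append eqv_refl) auto
    then show ?thesis
      using that d by (simp flip: wpow_add add: add.commute add.left_commute)
  qed
  have steps: "eqv M F r (wpow w (m + k * d)) (wpow w m)" if "i \<le> m" for m k
  proof (induction k)
    case (Suc k)
    have "eqv M F r (wpow w ((m + k * d) + d)) (wpow w (m + k * d))"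
      using that by (intro step) auto
    then show ?case using Suc eqv_trans by (metis add.assoc add.commute mult_Suc)
  qed (simp add: eqv_refl)
  \<comment> \<open>The exponent \<open>i * d\<close> is at least \<open>i\<close> and a multiple of
    the period, so doubling it does not leave the class.\<close>
  have "eqv M F r (wpow w (i * d + i * d)) (wpow w (i * d))"
    using d by (intro steps) auto
  then show ?thesis
    using d ij by (intro exI[of _ "i * d"]) (auto simp: wpow_add)
qed

text \<open>Every block except the two outer ones is read in the context \<open>E @ _ @ E\<close>, so permuting the
  inner blocks preserves the number of hits.\<close>

lemma hits_blocks:
  assumes "\<And>x y. eqv M F r x y \<Longrightarrow> P x = P y"
    and E: "eqv M F r (E @ E) E" and "\<And>b. b \<in> set bs \<Longrightarrow> eqv M F r b E"
    and "eqv M F r l E" and s: "eqv M F r s E"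
  shows "eqv M F r (l @ concat bs @ s) E \<and> hits f P (l @ concat bs @ s) =
    hits f (\<lambda>x. P (x @ E)) l + (\<Sum>b\<leftarrow>bs. hits f (\<lambda>x. P (E @ x @ E)) b) + hits f (\<lambda>x. P (E @ x)) s"
  using assms(1,3,4)
proof (induction bs arbitrary: l P)
  case Nil
  have "(\<lambda>x. P (x @ s)) = (\<lambda>x. P (x @ E))" "(\<lambda>x. P (l @ x)) = (\<lambda>x. P (E @ x))"
    using Nil eqv_append eqv_refl s by (metis (no_types, lifting))+
  moreover have "eqv M F r (l @ s) E"
    using eqv_trans[OF eqv_append[OF Nil(3) s] E] .
  ultimately show ?case by (simp add: hits_append)
next
  case (Cons b bs)
  have P': "P (E @ x) = P (E @ y)" if "eqv M F r x y" for x y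
    using Cons.prems(1) eqv_append[OF eqv_refl that] by blast
  have IH: "eqv M F r (b @ concat bs @ s) E"
    "hits f (\<lambda>x. P (E @ x)) (b @ concat bs @ s) =
      hits f (\<lambda>x. P (E @ x @ E)) b + (\<Sum>b\<leftarrow>bs. hits f (\<lambda>x. P (E @ E @ x @ E)) b)
        + hits f (\<lambda>x. P (E @ E @ x)) s"
    using Cons.IH[of "\<lambda>x. P (E @ x)" b] P' Cons.prems by auto
  \<comment> \<open>Idempotence absorbs the copy of \<open>E\<close> that stands for the prefix
    \<open>l\<close>, so contexts do not grow along the list.\<close>
  have "P (E @ E @ x) = P (E @ x)" for x
    using Cons.prems(1) eqv_append[OF E eqv_refl[of M F r x]] by simp
  note IH = IH(1) IH(2)[unfolded this]
  have "(\<lambda>x. P (x @ b @ concat bs @ s)) = (\<lambda>x. P (x @ E))" "(\<lambda>x. P (l @ x)) = (\<lambda>x. P (E @ x))"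
    using Cons.prems(1,3) eqv_append eqv_refl IH(1) by (metis (no_types, lifting))+
  then have "hits f P (l @ (b @ concat bs @ s)) =
      hits f (\<lambda>x. P (x @ E)) l + hits f (\<lambda>x. P (E @ x)) (b @ concat bs @ s)"
    by (subst hits_append) simp
  moreover have "eqv M F r (l @ (b @ concat bs @ s)) E"
    using eqv_trans[OF eqv_append[OF Cons.prems(3) IH(1)] E] .
  ultimately show ?case using IH by simp
qed

text \<open>By \<open>hits_blocks\<close> the count is a sum over the inner blocks and depends only
  on their multiset; the counts are equal, not merely congruent.\<close>

lemma eqv_Suc_blocks:
  assumes E: "eqv M F r (E @ E) E" and B: "\<And>b. b \<in> set bs \<Longrightarrow> eqv M F r b E"
    and l: "eqv M F r l E" and s: "eqv M F r s E" and bs: "mset bs = mset bs'"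
  shows "eqv M F (Suc r) (l @ concat bs @ s) (l @ concat bs' @ s)"
proof -
  have B': "\<And>b. b \<in> set bs' \<Longrightarrow> eqv M F r b E" using B bs by (metis set_mset_mset)
  have "hits f P (l @ concat bs @ s) = hits f P (l @ concat bs' @ s)"
    if P: "\<forall>x y. eqv M F r x y \<longrightarrow> P x = P y" for f P
  proof -
    have "(\<Sum>b\<leftarrow>bs. h b) = (\<Sum>b\<leftarrow>bs'. h b)" for h :: "_ \<Rightarrow> nat"
      using bs by (metis sum_mset_sum_list mset_map)
    then show ?thesis
      using hits_blocks[OF _ E B l s, where bs = bs and P = P and f = f] hits_blocks[OF _ E B' l s, where bs = bs' and P = P and f = f] P by auto
  qed
  moreover have "eqv M F r (l @ concat bs @ s) (l @ concat bs' @ s)"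
    using hits_blocks[OF _ E B l s, where bs = bs and P = "\<lambda>_. True"] hits_blocks[OF _ E B' l s, where bs = bs' and P = "\<lambda>_. True"]
    by (meson eqv_trans eqv_sym)
  ultimately show ?thesis by (auto simp: agree_refl)
qed

subsection \<open>Words of three-cycles\<close>

definition cyc :: "nat \<Rightarrow> nat \<Rightarrow> nat \<Rightarrow> nat \<Rightarrow> nat" where
  "cyc a b c = id(a := b, b := c, c := a)"

primrec track :: "(nat \<Rightarrow> nat) list \<Rightarrow> nat \<Rightarrow> nat" where
  "track [] i = i"
| "track (s # w) i = track w (s i)"

lemma track_append: "track (u @ v) i = track v (track u i)"
  by (induction u arbitrary: i) auto

lemma track_wpow_id: "track w = id \<Longrightarrow> track (wpow w n) = id"
  by (induction n) (auto simp: track_append fun_eq_iff)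

text \<open>A letter describes one column: the flag tells whether its vertices form a path, the
  permutation leads to the next column, and a pair \<open>(j, i)\<close> in the set places mark
  \<open>j\<close> on track \<open>i\<close>.\<close>

type_synonym letter = "(bool \<times> (nat \<Rightarrow> nat)) \<times> (nat \<times> nat) set"

definition add_mark :: "nat \<times> nat \<Rightarrow> letter \<Rightarrow> letter" where
  "add_mark m a = (fst a, insert m (snd a))"

text \<open>Bounding the mark names by \<open>K\<close> keeps the alphabet of marked letters finite,
  as finite index requires.\<close>

definition markings :: "nat \<Rightarrow> (letter \<Rightarrow> letter) set" where
  "markings K = add_mark ` ({..<K} \<times> {..<5})"

definition plain :: "(nat \<Rightarrow> nat) list \<Rightarrow> letter list" where
  "plain w = map (\<lambda>s. ((False, s), {})) w"

lemma plain_append: "plain (u @ v) = plain u @ plain v"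
  by (simp add: plain_def)

lemma plain_concat: "plain (concat ws) = concat (map plain ws)"
  by (induction ws) (auto simp: plain_def)

lemma plain_idempotent_power:
  assumes "0 < M"
  shows "\<exists>n>0. eqv M (markings K) r (plain (wpow w n) @ plain (wpow w n)) (plain (wpow w n))"
proof -
  let ?A = "(Pair False ` set w) \<times> Pow ({..<K} \<times> {..<5})"
  have "\<exists>n>0. eqv M (markings K) r (wpow (plain w) n @ wpow (plain w) n) (wpow (plain w) n)"
    by (rule eqv_idempotent_power[where A = ?A])
       (use assms in \<open>auto simp: markings_def add_mark_def plain_def\<close>)
  then show ?thesis by (simp add: plain_concat)
qed

definition three_cycle :: "(nat \<Rightarrow> nat) \<Rightarrow> bool" where
  "three_cycle g \<longleftrightarrow> (\<exists>a b c. distinct [a, b, c] \<and> {a, b, c} \<subseteq> {..<5} \<and> g = cyc a b c)"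

lemma three_cycle_cube: "three_cycle x \<Longrightarrow> x (x (x i)) = i"
  unfolding three_cycle_def cyc_def by auto

text \<open>The commutator of two three-cycles that share exactly one point is a three-cycle; the
  two further points \<open>d\<close> and \<open>e\<close> exist because there are five tracks.
  Inverses are written as squares, so that the trivial word \<open>x x x y y y\<close> has the same
  letters with the same multiplicities.\<close>

lemma three_cycle_commutator:
  assumes "three_cycle g"
  obtains x y where "three_cycle x" "three_cycle y" "track [x, y, x, x, y, y] = g"
proof -
  obtain a b c where abc: "distinct [a, b, c]" "{a, b, c} \<subseteq> {..<5}" "g = cyc a b c"
    using assms three_cycle_def by blast
  have "card ({..<5} - {a, b, c}) = 2"
    using abc by (subst card_Diff_subset) auto
  then obtain d e where de: "{..<5} - {a, b, c} = {d, e}" "d \<noteq> e"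
    by (auto simp: card_2_iff)
  then have "d \<in> {..<5} - {a, b, c}" "e \<in> {..<5} - {a, b, c}" by auto
  then have D: "distinct [a, b, c, d, e]" "{a, b, c, d, e} \<subseteq> {..<5}" using abc de(2) by auto
  show ?thesis
  proof
    show "three_cycle (cyc a b d)" "three_cycle (cyc b e c)"
      unfolding three_cycle_def using D by fastforce+
    show "track [cyc a b d, cyc b e c, cyc a b d, cyc a b d, cyc b e c, cyc b e c] = g"
      using D unfolding abc(3) by (auto simp: cyc_def fun_eq_iff)
  qed
qed

lemma cyclic_and_trivial_words_eqv:
  assumes M: "0 < M" and g: "three_cycle g"
  shows "\<exists>u v. eqv M (markings K) r (plain u) (plain v) \<and> track u = g \<and> track v = id \<and>
    set u \<subseteq> Collect three_cycle \<and> set v \<subseteq> Collect three_cycle"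
  using g
proof (induction r arbitrary: g)
  case 0
  obtain x y where xy: "three_cycle x" "three_cycle y" "track [x, y, x, x, y, y] = g"
    using three_cycle_commutator[OF 0] .
  \<comment> \<open>The padding \<open>d\<close> has product 1 and already contains every ordered
    pair and every adjacent pair over \<open>x\<close> and \<open>y\<close>, so the middle part does
    not influence the code.\<close>
  define d where "d = [x, x, x, y, y, y, x, x, x]"
  let ?u = "d @ [x, y, x, x, y, y] @ d" and ?v = "d @ [x, x, x, y, y, y] @ d"
  have d: "track d i = i" for i
    using three_cycle_cube[OF xy(1)] three_cycle_cube[OF xy(2)] by (simp add: d_def)
  have "word_code (plain ?u) = word_code (plain ?v)"
    unfolding word_code_def plain_def d_def by (simp add: insert_commute Un_ac)
  moreover have "track ?u = g"
    using xy(3) by (auto simp: track_append d fun_eq_iff)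
  moreover have "track ?v = id"
    using three_cycle_cube[OF xy(1)] three_cycle_cube[OF xy(2)] by (auto simp: track_append d fun_eq_iff)
  moreover have "set ?u \<subseteq> Collect three_cycle" "set ?v \<subseteq> Collect three_cycle"
    using xy by (auto simp: d_def)
  ultimately show ?case by (metis eqv.simps(1))
next
  case (Suc r)
  obtain x y where xy: "three_cycle x" "three_cycle y" "track [x, y, x, x, y, y] = g"
    using three_cycle_commutator[OF Suc.prems] .
  obtain ux vx where x: "eqv M (markings K) r (plain ux) (plain vx)" "track ux = x" "track vx = id"
    "set ux \<subseteq> Collect three_cycle" "set vx \<subseteq> Collect three_cycle"
    using Suc.IH[OF xy(1)] by blast
  obtain uy vy where y: "eqv M (markings K) r (plain uy) (plain vy)" "track uy = y" "track vy = id"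
    "set uy \<subseteq> Collect three_cycle" "set vy \<subseteq> Collect three_cycle"
    using Suc.IH[OF xy(2)] by blast
  obtain n where "n > 0" and n: "eqv M (markings K) r (plain (wpow (vx @ vy) n) @ plain (wpow (vx @ vy) n))
      (plain (wpow (vx @ vy) n))"
    using plain_idempotent_power[OF M, where w = "vx @ vy"] by blast
  \<comment> \<open>One factor \<open>vx @ vy\<close> of the idempotent power is split off, hence
    \<open>n - 1\<close>; replacing \<open>vx\<close> or \<open>vy\<close> in it gives blocks with
    product \<open>x\<close> or \<open>y\<close> that remain equivalent to \<open>e\<close>.\<close>
  define C where "C = wpow (vx @ vy) (n - 1)"
  define e where "e = vx @ vy @ C"
  define p where "p = ux @ vy @ C"
  define q where "q = vx @ uy @ C"
  have "wpow (vx @ vy) n = e"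
    using \<open>n > 0\<close> by (cases n) (auto simp: e_def C_def)
  note E = n[unfolded this]
  have pe: "eqv M (markings K) r (plain p) (plain e)" and qe: "eqv M (markings K) r (plain q) (plain e)"
    unfolding p_def q_def e_def plain_append by (intro eqv_append eqv_refl x y)+
  have C: "track C = id"
    unfolding C_def by (rule track_wpow_id) (simp add: track_append x y fun_eq_iff)
  have t: "track e i = i" "track p i = x i" "track q i = y i" for i
    by (auto simp: e_def p_def q_def track_append C x y)
  have "set (wpow (vx @ vy) k) \<subseteq> Collect three_cycle" for k
    using x y by (induction k) auto
  then have s: "set e \<subseteq> Collect three_cycle" "set p \<subseteq> Collect three_cycle" "set q \<subseteq> Collect three_cycle"
    using x y unfolding e_def p_def q_def C_def by auto
  \<comment> \<open>The same multiset of blocks: in the first order they multiply to the commutator,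
    in the second the cubes cancel.\<close>
  let ?u = "e @ concat [p, q, p, p, q, q] @ e" and ?v = "e @ concat [p, p, p, q, q, q] @ e"
  have "eqv M (markings K) (Suc r) (plain e @ concat (map plain [p, q, p, p, q, q]) @ plain e)
      (plain e @ concat (map plain [p, p, p, q, q, q]) @ plain e)"
    by (rule eqv_Suc_blocks[OF E]) (use pe qe eqv_refl in auto)
  then have "eqv M (markings K) (Suc r) (plain ?u) (plain ?v)"
    by (simp only: plain_append plain_concat)
  moreover have "track ?u = g"
    using xy(3) by (auto simp: track_append t fun_eq_iff)
  moreover have "track ?v = id"
    using three_cycle_cube[OF xy(1)] three_cycle_cube[OF xy(2)] by (auto simp: track_append t fun_eq_iff)
  moreover have "set ?u \<subseteq> Collect three_cycle" "set ?v \<subseteq> Collect three_cycle"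
    using s by auto
  ultimately show ?case by blast
qed

subsection \<open>Ladder graphs and formulas\<close>

text \<open>Vertex \<open>5 * q + i\<close> is track \<open>i\<close> of column \<open>q\<close>, so
  the order of the numbers is the order of columns refined by the tracks.\<close>

definition ladder_step :: "(bool \<times> (nat \<Rightarrow> nat)) list \<Rightarrow> nat \<Rightarrow> nat \<Rightarrow> bool" where
  "ladder_step w a b \<longleftrightarrow> a < 5 * length w \<and> b < 5 * length w \<and>
     (a div 5 = b div 5 \<and> fst (w ! (a div 5)) \<and> Suc (a mod 5) = b mod 5 \<or>
      Suc (a div 5) = b div 5 \<and> snd (w ! (a div 5)) (a mod 5) = b mod 5)"

definition ladder :: "(bool \<times> (nat \<Rightarrow> nat)) list \<Rightarrow> nat pair_pre_digraph" where
  "ladder w = \<lparr>pverts = {..<5 * length w}, parcs = {(a, b). ladder_step w a b \<or> ladder_step w b a}\<rparr>"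

definition less_upto :: "nat \<Rightarrow> nat rel" where
  "less_upto n = {(a, b). a < b \<and> b < n}"

lemma pair_graph_ladder: "pair_graph (ladder w)"
proof
  have "parcs (ladder w) \<subseteq> pverts (ladder w) \<times> pverts (ladder w)"
    by (auto simp: ladder_def ladder_step_def)
  then show "finite (parcs (ladder w))"
    by (rule finite_subset) (simp add: ladder_def)
qed (auto simp: ladder_def ladder_step_def symmetric_def sym_def)

lemma strict_linear_order_less_upto: "strict_linear_order_on {..<n} (less_upto n)"
  by (auto simp: strict_linear_order_on_def less_upto_def trans_def irrefl_def total_on_def)

primrec qdepth :: "cfol \<Rightarrow> nat" where
  "qdepth (Eq x y) = 0"
| "qdepth (Adj x y) = 0"
| "qdepth (Less x y) = 0"
| "qdepth (Neg \<phi>) = qdepth \<phi>"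
| "qdepth (Conj \<phi> \<psi>) = max (qdepth \<phi>) (qdepth \<psi>)"
| "qdepth (Exists x \<phi>) = Suc (qdepth \<phi>)"
| "qdepth (ModEx m i x \<phi>) = Suc (qdepth \<phi>)"

text \<open>A common multiple of all moduli in the formula, to serve as \<open>M\<close>.\<close>

primrec modulus :: "cfol \<Rightarrow> nat" where
  "modulus (Eq x y) = 1"
| "modulus (Adj x y) = 1"
| "modulus (Less x y) = 1"
| "modulus (Neg \<phi>) = modulus \<phi>"
| "modulus (Conj \<phi> \<psi>) = modulus \<phi> * modulus \<psi>"
| "modulus (Exists x \<phi>) = modulus \<phi>"
| "modulus (ModEx m i x \<phi>) = m * modulus \<phi>"

lemma modulus_pos: "pos_moduli \<phi> \<Longrightarrow> 0 < modulus \<phi>"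
  by (induction \<phi>) auto

section \<open>Assignments encoded as marks, and the transfer of formulas\<close>

definition located :: "letter list \<Rightarrow> nat \<Rightarrow> nat \<Rightarrow> bool" where
  "located u j a \<longleftrightarrow> a < 5 * length u \<and>
     (\<forall>q<length u. \<forall>i. (j, i) \<in> snd (u ! q) \<longleftrightarrow> q = a div 5 \<and> i = a mod 5)"

text \<open>Every quantifier gets a fresh mark name \<open>k\<close>, and \<open>\<rho>\<close> maps variables to the names of their
  current marks; thus a requantified variable needs no removal of marks.\<close>

definition marked :: "nat \<Rightarrow> letter list \<Rightarrow> (nat \<Rightarrow> nat) \<Rightarrow> (nat \<Rightarrow> nat) \<Rightarrow> nat set \<Rightarrow> bool" where
  "marked k u \<rho> s X \<longleftrightarrow> (\<forall>x\<in>X. \<rho> x < k \<and> located u (\<rho> x) (s x)) \<and>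
     (\<forall>j\<ge>k. \<forall>q<length u. \<forall>i. (j, i) \<notin> snd (u ! q))"

lemma marked_mono: "marked k u \<rho> s X \<Longrightarrow> Y \<subseteq> X \<Longrightarrow> marked k u \<rho> s Y"
  by (auto simp: marked_def)

text \<open>The name \<open>k\<close> has not occurred before, so the new mark is the only one of
  this name and leaves the others as they are.\<close>

lemma marked_update:
  assumes "marked k u \<rho> s (X - {x})" "q < length u" "i < 5"
  shows "marked (Suc k) (u[q := add_mark (k, i) (u ! q)]) (\<rho>(x := k)) (s(x := 5 * q + i)) X"
proof -
  let ?u = "u[q := add_mark (k, i) (u ! q)]"
  have new: "located ?u k (5 * q + i)"
    using assms unfolding located_def marked_def
    by (auto simp: nth_list_update add_mark_def)
  have old: "located ?u j a" if "located u j a" "j < k" for j a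
    using that assms(2) unfolding located_def
    by (auto simp: nth_list_update add_mark_def)
  have "(j, i') \<notin> snd (?u ! q')" if "j \<ge> Suc k" "q' < length u" for j q' i'
    using that assms unfolding marked_def by (auto simp: nth_list_update add_mark_def)
  then show ?thesis
    using new old assms(1) unfolding marked_def by (auto simp: less_SucI)
qed

lemma located_nth:
  "located u j a \<Longrightarrow> q < length u \<Longrightarrow> (j, i) \<in> snd (u ! q) \<longleftrightarrow> q = a div 5 \<and> i = a mod 5"
  by (simp add: located_def)

lemma located_div: "located u j a \<Longrightarrow> a div 5 < length u"
  by (auto simp: located_def)

lemma ex_Collect1: "(\<exists>z\<in>{f p | p. A p}. Q z) \<longleftrightarrow> (\<exists>p. A p \<and> Q (f p))"
  and ex_Collect2: "(\<exists>z\<in>{g p q | p q. B p q}. Q z) \<longleftrightarrow> (\<exists>p q. B p q \<and> Q (g p q))"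
  by blast+

text \<open>Each mark sits at one position, which turns the existence of letters with given marks
  into a statement about two vertices. The left sides here and in the next two lemmas depend on
  \<open>word_code u\<close> alone.\<close>

lemma located_set:
  assumes "located u j a" "located u j' b"
  shows "(\<exists>l\<in>set u. \<exists>i i'. (j, i) \<in> snd l \<and> (j', i') \<in> snd l \<and> R l i i') \<longleftrightarrow>
    a div 5 = b div 5 \<and> R (u ! (a div 5)) (a mod 5) (b mod 5)" (is "?L \<longleftrightarrow> ?R")
proof -
  have "?L \<longleftrightarrow> (\<exists>q<length u. \<exists>i i'. (j, i) \<in> snd (u ! q) \<and> (j', i') \<in> snd (u ! q) \<and> R (u ! q) i i')"
    unfolding set_conv_nth by blast
  also have "\<dots> \<longleftrightarrow> (\<exists>q<length u. \<exists>i i'. (q = a div 5 \<and> i = a mod 5) \<and> (q = b div 5 \<and> i' = b mod 5) \<and> R (u ! q) i i')"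
    using assms by (intro ex_cong1 conj_cong refl) (simp_all add: located_nth)
  also have "\<dots> \<longleftrightarrow> ?R" using located_div[OF assms(1)] by auto
  finally show ?thesis .
qed

lemma located_pairs:
  assumes "located u j a" "located u j' b"
  shows "(\<exists>z\<in>pairs u. \<exists>i i'. (j, i) \<in> snd (fst z) \<and> (j', i') \<in> snd (snd z)) \<longleftrightarrow> a div 5 < b div 5"
    (is "?L \<longleftrightarrow> ?R")
proof -
  have "?L \<longleftrightarrow> (\<exists>p q. p < q \<and> q < length u \<and> (\<exists>i i'. (j, i) \<in> snd (u ! p) \<and> (j', i') \<in> snd (u ! q)))"
    unfolding pairs_eq ex_Collect2 by (simp only: fst_conv snd_conv conj_assoc)
  also have "\<dots> \<longleftrightarrow> (\<exists>p q. p < q \<and> q < length u \<and> (\<exists>i i'. (p = a div 5 \<and> i = a mod 5) \<and> (q = b div 5 \<and> i' = b mod 5)))"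
    using assms by (intro ex_cong1 conj_cong refl) (simp_all add: located_nth)
  also have "\<dots> \<longleftrightarrow> ?R" using located_div[OF assms(2)] by auto
  finally show ?thesis .
qed

lemma located_steps:
  assumes "located u j a" "located u j' b"
  shows "(\<exists>z\<in>steps u. \<exists>i i'. (j, i) \<in> snd (fst z) \<and> (j', i') \<in> snd (snd z) \<and> R (fst z) i i') \<longleftrightarrow>
    Suc (a div 5) = b div 5 \<and> R (u ! (a div 5)) (a mod 5) (b mod 5)" (is "?L \<longleftrightarrow> ?R")
proof -
  have "?L \<longleftrightarrow> (\<exists>p. Suc p < length u \<and> (\<exists>i i'. (j, i) \<in> snd (u ! p) \<and> (j', i') \<in> snd (u ! Suc p) \<and> R (u ! p) i i'))"
    unfolding steps_eq ex_Collect1 by (simp only: fst_conv snd_conv)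
  also have "\<dots> \<longleftrightarrow> (\<exists>p. Suc p < length u \<and>
      (\<exists>i i'. (p = a div 5 \<and> i = a mod 5) \<and> (Suc p = b div 5 \<and> i' = b mod 5) \<and> R (u ! p) i i'))"
    using assms by (intro ex_cong1 conj_cong refl) (simp_all add: located_nth)
  also have "\<dots> \<longleftrightarrow> ?R" using located_div[OF assms(2)] by auto
  finally show ?thesis .
qed

lemma ladder_step_transfer:
  assumes "word_code u = word_code v" "located u j a" "located u j' b" "located v j a'" "located v j' b'"
  shows "ladder_step (map fst u) a b \<longleftrightarrow> ladder_step (map fst v) a' b'"
proof -
  have len: "a < 5 * length u" "b < 5 * length u" "a' < 5 * length v" "b' < 5 * length v"
    using assms by (auto simp: located_def)
  then have "a div 5 < length u" "a' div 5 < length v" by auto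
  then show ?thesis
    using located_set[OF assms(2,3), of "\<lambda>l i i'. fst (fst l) \<and> Suc i = i'"]
      located_set[OF assms(4,5), of "\<lambda>l i i'. fst (fst l) \<and> Suc i = i'"]
      located_steps[OF assms(2,3), of "\<lambda>l i i'. snd (fst l) i = i'"]
      located_steps[OF assms(4,5), of "\<lambda>l i i'. snd (fst l) i = i'"] assms(1) len
    by (simp add: ladder_step_def word_code_def)
qed

text \<open>The order is lexicographic in column and track: \<open>pairs\<close> decides the
  columns, a common letter the tracks.\<close>

lemma less_transfer:
  assumes "word_code u = word_code v" "located u j a" "located u j' b" "located v j a'" "located v j' b'"
  shows "a < b \<longleftrightarrow> a' < b'"
proof -
  have *: "a < b \<longleftrightarrow> a div 5 < b div 5 \<or> a div 5 = b div 5 \<and> a mod 5 < b mod 5" for a b :: nat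
  proof -
    have "5 * q + i < 5 * p + j \<longleftrightarrow> q < p \<or> q = p \<and> i < j" if "i < 5" "j < 5" for i j p q :: nat
      using that by linarith
    from this[of "a mod 5" "b mod 5" "a div 5" "b div 5"] show ?thesis by simp
  qed
  show ?thesis
    using located_set[OF assms(2,3), of "\<lambda>l i i'. i < i'"]
      located_set[OF assms(4,5), of "\<lambda>l i i'. i < i'"]
      located_pairs[OF assms(2,3)] located_pairs[OF assms(4,5)] assms(1)
    unfolding * [of a b] * [of a' b'] by (simp add: word_code_def)
qed

text \<open>Counting vertices amounts to counting positions once for each of the five
  tracks.\<close>

lemma card_split_mod5:
  "card {a. a < 5 * n \<and> R a} = (\<Sum>i<5. card {q. q < n \<and> R (5 * q + i)})" for n :: nat
proof -
  have "{a. a < 5 * n \<and> R a} = (\<Union>i<5. (\<lambda>q. 5 * q + i) ` {q. q < n \<and> R (5 * q + i)})" (is "_ = ?U")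
  proof (intro equalityI subsetI)
    fix a assume "a \<in> {a. a < 5 * n \<and> R a}"
    then have "a = 5 * (a div 5) + a mod 5" "a mod 5 < 5" "a div 5 \<in> {q. q < n \<and> R (5 * q + a mod 5)}"
      by auto
    then show "a \<in> ?U" by blast
  qed auto
  moreover have "card ?U = (\<Sum>i<5. card ((\<lambda>q. 5 * q + i) ` {q. q < n \<and> R (5 * q + i)}))"
  proof (rule card_UN_disjoint)
    show "\<forall>i\<in>{..<5}. \<forall>j\<in>{..<5}. i \<noteq> j \<longrightarrow>
      (\<lambda>q. 5 * q + i) ` {q. q < n \<and> R (5 * q + i)} \<inter> (\<lambda>q. 5 * q + j) ` {q. q < n \<and> R (5 * q + j)} = {}"
      by (auto, presburger)
  qed auto
  moreover have "card ((\<lambda>q. 5 * q + i) ` X) = card X" for i :: nat and X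
    by (rule card_image) (auto simp: inj_on_def)
  ultimately show ?thesis by simp
qed

lemma agree_sum:
  assumes "\<And>i. i \<in> I \<Longrightarrow> agree M (f i) (g i)"
  shows "agree M (sum f I) (sum g I)"
  using assms
proof (induction I rule: infinite_finite_induct)
qed (auto simp: agree_refl intro: agree_add)

abbreviation holds :: "letter list \<Rightarrow> (nat \<Rightarrow> nat) \<Rightarrow> cfol \<Rightarrow> bool" where
  "holds u \<equiv> sat (ladder (map fst u)) (less_upto (5 * length u))"

lemma holds_list_update: "holds (u[q := add_mark m (u ! q)]) s \<phi> \<longleftrightarrow> holds u s \<phi>"
proof -
  have "map fst (u[q := add_mark m (u ! q)]) = map fst u"
    by (rule nth_equalityI; cases "q < length u") (auto simp: nth_list_update add_mark_def)
  then show ?thesis by simp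
qed

text \<open>A quantified vertex is simulated by a fresh mark \<open>k\<close> on each track in turn;
  the hits agree track by track, hence so do their sums.\<close>

lemma card_holds_agree:
  assumes transfer: "\<And>u v s s' \<rho>. eqv M (markings K) r u v \<Longrightarrow> marked (Suc k) u \<rho> s (fv \<phi>) \<Longrightarrow>
      marked (Suc k) v \<rho> s' (fv \<phi>) \<Longrightarrow> holds u s \<phi> \<longleftrightarrow> holds v s' \<phi>"
    and "k < K" and uv: "eqv M (markings K) (Suc r) u v"
    and u: "marked k u \<rho> s (fv \<phi> - {x})" and v: "marked k v \<rho> s' (fv \<phi> - {x})"
  shows "agree M (card {a \<in> pverts (ladder (map fst u)). holds u (s(x := a)) \<phi>})
    (card {a \<in> pverts (ladder (map fst v)). holds v (s'(x := a)) \<phi>})"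
proof -
  \<comment> \<open>The marks determine the assignment only in properly marked words, so
    \<open>P\<close> is closed under equivalence to be invariant; by \<open>transfer\<close> it is
    the truth value on marked words.\<close>
  define P where "P t \<longleftrightarrow> (\<exists>t' s'. eqv M (markings K) r t t' \<and>
    marked (Suc k) t' (\<rho>(x := k)) s' (fv \<phi>) \<and> holds t' s' \<phi>)" for t
  have P: "\<forall>t t'. eqv M (markings K) r t t' \<longrightarrow> P t = P t'"
    unfolding P_def using eqv_trans eqv_sym by meson
  have PI: "P t \<longleftrightarrow> holds t s \<phi>" if "marked (Suc k) t (\<rho>(x := k)) s (fv \<phi>)" for t s
    unfolding P_def using transfer[OF _ that] that eqv_refl by metis
  have count: "card {a \<in> pverts (ladder (map fst u)). holds u (s(x := a)) \<phi>} =
      (\<Sum>i<5. hits (add_mark (k, i)) P u)" if u: "marked k u \<rho> s (fv \<phi> - {x})" for u s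
  proof -
    have "holds u (s(x := 5 * q + i)) \<phi> \<longleftrightarrow> P (u[q := add_mark (k, i) (u ! q)])"
      if "q < length u" "i < 5" for q i
      using PI[OF marked_update[OF u that]] by (simp only: holds_list_update)
    then have "{q. q < length u \<and> holds u (s(x := 5 * q + i)) \<phi>} =
        {q. q < length u \<and> P (u[q := add_mark (k, i) (u ! q)])}" if "i < 5" for i
      using that by blast
    then show ?thesis
      using card_split_mod5[of "length u" "\<lambda>a. holds u (s(x := a)) \<phi>"]
      by (simp add: hits_def ladder_def)
  qed
  have "agree M (hits (add_mark (k, i)) P u) (hits (add_mark (k, i)) P v)" if "i < 5" for i
    using uv P that \<open>k < K\<close> by (auto simp: markings_def)
  then show ?thesis
    unfolding count[OF u] count[OF v] by (intro agree_sum) auto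
qed

text \<open>Induction on the formula. The names below \<open>k\<close> may be in use, and
  \<open>k + qdepth \<phi> \<le> K\<close> leaves a fresh name for every nested quantifier.\<close>

lemma holds_transfer:
  assumes "modulus \<phi> dvd M" "k + qdepth \<phi> \<le> K" "eqv M (markings K) (qdepth \<phi>) u v"
    and "marked k u \<rho> s (fv \<phi>)" "marked k v \<rho> s' (fv \<phi>)"
  shows "holds u s \<phi> \<longleftrightarrow> holds v s' \<phi>"
  using assms
proof (induction \<phi> arbitrary: k u v \<rho> s s')
  case (Eq x y)
  then have "located u (\<rho> x) (s x)" "located u (\<rho> y) (s y)" "located v (\<rho> x) (s' x)" "located v (\<rho> y) (s' y)"
    "word_code u = word_code v" by (auto simp: marked_def)
  \<comment> \<open>Equality is the absence of strict order in both directions.\<close>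
  note less_transfer[OF this(5,1,2,3,4)] less_transfer[OF this(5,2,1,4,3)]
  then show ?case by auto
next
  case (Adj x y)
  then have "located u (\<rho> x) (s x)" "located u (\<rho> y) (s y)" "located v (\<rho> x) (s' x)" "located v (\<rho> y) (s' y)"
    "word_code u = word_code v" by (auto simp: marked_def)
  note ladder_step_transfer[OF this(5,1,2,3,4)] ladder_step_transfer[OF this(5,2,1,4,3)]
  then show ?case by (simp add: ladder_def)
next
  case (Less x y)
  then have *: "located u (\<rho> x) (s x)" "located u (\<rho> y) (s y)" "located v (\<rho> x) (s' x)" "located v (\<rho> y) (s' y)"
    "word_code u = word_code v" by (auto simp: marked_def)
  have "s y < 5 * length u" "s' y < 5 * length v" using * by (auto simp: located_def)
  with less_transfer[OF *(5,1,2,3,4)] show ?case by (simp add: less_upto_def)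
next
  case (Neg \<phi>)
  then show ?case by simp
next
  case (Conj \<phi> \<psi>)
  have "modulus \<phi> dvd M" "modulus \<psi> dvd M"
    using Conj.prems(1) by (auto intro: dvd_mult_left dvd_mult_right)
  moreover have "eqv M (markings K) (qdepth \<phi>) u v" "eqv M (markings K) (qdepth \<psi>) u v"
    using Conj.prems(3) by (auto intro: eqv_mono)
  moreover have "marked k u \<rho> s (fv \<phi>)" "marked k v \<rho> s' (fv \<phi>)" "marked k u \<rho> s (fv \<psi>)" "marked k v \<rho> s' (fv \<psi>)"
    using Conj.prems(4,5) by (auto elim: marked_mono)
  ultimately show ?case
    using Conj.IH[of k u v \<rho> s s'] Conj.prems(2) by simp
next
  case (Exists x \<phi>)
  have "agree M (card {a \<in> pverts (ladder (map fst u)). holds u (s(x := a)) \<phi>})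
    (card {a \<in> pverts (ladder (map fst v)). holds v (s'(x := a)) \<phi>})"
    proof (rule card_holds_agree[where r = "qdepth \<phi>" and k = k and K = K and \<rho> = \<rho>])
    show "holds u s \<phi> \<longleftrightarrow> holds v s' \<phi>" if "eqv M (markings K) (qdepth \<phi>) u v"
      "marked (Suc k) u \<rho> s (fv \<phi>)" "marked (Suc k) v \<rho> s' (fv \<phi>)" for u v s s' \<rho>
      by (rule Exists.IH[of "Suc k"]) (use Exists.prems that  in auto)
  qed (use Exists.prems in \<open>auto simp del: eqv.simps\<close>)
  \<comment> \<open>Finiteness lets a count of 0 mean that there is no witness.\<close>
  moreover have "finite (pverts (ladder w))" for w by (simp add: ladder_def)
  ultimately show ?case by (auto simp: agree_def)
next
  case (ModEx m i x \<phi>)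
  have M: "m dvd M" "modulus \<phi> dvd M"
    using ModEx.prems(1) by (auto intro: dvd_mult_left dvd_mult_right)
  have "agree M (card {a \<in> pverts (ladder (map fst u)). holds u (s(x := a)) \<phi>})
    (card {a \<in> pverts (ladder (map fst v)). holds v (s'(x := a)) \<phi>})"
    proof (rule card_holds_agree[where r = "qdepth \<phi>" and k = k and K = K and \<rho> = \<rho>])
    show "holds u s \<phi> \<longleftrightarrow> holds v s' \<phi>" if "eqv M (markings K) (qdepth \<phi>) u v"
      "marked (Suc k) u \<rho> s (fv \<phi>)" "marked (Suc k) v \<rho> s' (fv \<phi>)" for u v s s' \<rho>
      by (rule ModEx.IH[of "Suc k"]) (use ModEx.prems that M in auto)
  qed (use ModEx.prems in \<open>auto simp del: eqv.simps\<close>)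
  then have "[card {a \<in> pverts (ladder (map fst u)). holds u (s(x := a)) \<phi>} =
    card {a \<in> pverts (ladder (map fst v)). holds v (s'(x := a)) \<phi>}] (mod m)"
    using M(1) cong_dvd_modulus_nat by (auto simp: agree_def)
  then show ?case
    by (simp add: cong_def)
qed

text \<open>The two bounding letters carry the flags, so that the outermost columns of the ladder become paths.\<close>

definition framed :: "(nat \<Rightarrow> nat) list \<Rightarrow> (bool \<times> (nat \<Rightarrow> nat)) list" where
  "framed w = (True, id) # map (Pair False) w @ [(True, id)]"

text \<open>The quantifier depth and the \<open>modulus\<close> of a candidate sentence fix the
  parameters of the equivalence; the two words found for them, once framed, satisfy the sentence
  alike. As no variable is free, the empty marking suffices.\<close>

lemma not_definable_if_separates_tracks:
  assumes g: "three_cycle g"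
    and sep: "\<And>u. set u \<subseteq> Collect three_cycle \<Longrightarrow> track u = g \<Longrightarrow> ladder (framed u) \<notin> C"
      "\<And>u. set u \<subseteq> Collect three_cycle \<Longrightarrow> track u = id \<Longrightarrow> ladder (framed u) \<in> C"
  shows "\<not> cfol_definable_on_ordered_graphs C"
proof
  assume "cfol_definable_on_ordered_graphs C"
  then obtain \<phi> where \<phi>: "cfol_sentence \<phi>"
    "\<And>G L. pair_graph G \<Longrightarrow> L \<subseteq> pverts G \<times> pverts G \<Longrightarrow> strict_linear_order_on (pverts G) L \<Longrightarrow>
      models G L \<phi> \<longleftrightarrow> G \<in> C"
    unfolding cfol_definable_on_ordered_graphs_def by blast
  have fv: "fv \<phi> = {}" and M: "0 < modulus \<phi>"
    using \<phi>(1) by (auto simp: cfol_sentence_def intro: modulus_pos)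
  define r where "r = qdepth \<phi>"
  obtain u v where uv: "eqv (modulus \<phi>) (markings r) r (plain u) (plain v)" "track u = g" "track v = id"
    "set u \<subseteq> Collect three_cycle" "set v \<subseteq> Collect three_cycle"
    using cyclic_and_trivial_words_eqv[OF M g] by blast
  define ends where "ends w = [((True, id), {})] @ plain w @ [((True, id), {})]" for w
  have fst: "map fst (ends w) = framed w" for w
    by (simp add: ends_def framed_def plain_def)
  have "eqv (modulus \<phi>) (markings r) r (ends u) (ends v)"
    unfolding ends_def by (intro eqv_append eqv_refl uv)
  moreover have "marked 0 (ends w) id s {}" for w s
    by (auto simp: marked_def ends_def plain_def nth_Cons nth_append split: nat.splits)
  ultimately have "holds (ends u) s \<phi> \<longleftrightarrow> holds (ends v) s \<phi>" for s
    using holds_transfer[of \<phi> "modulus \<phi>" 0 r "ends u" "ends v" id s s] fv by (simp add: r_def)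
  moreover have "(\<forall>s. holds (ends w) s \<phi>) \<longleftrightarrow> ladder (framed w) \<in> C" for w
  proof -
    have "models (ladder (framed w)) (less_upto (5 * length (framed w))) \<phi> \<longleftrightarrow> ladder (framed w) \<in> C"
      by (rule \<phi>(2)[OF pair_graph_ladder])
         (auto simp: ladder_def less_upto_def strict_linear_order_less_upto[unfolded less_upto_def])
    moreover have "length (ends w) = length (framed w)" by (simp flip: fst)
    ultimately show ?thesis by (simp add: models_def fst)
  qed
  ultimately show False using sep uv by blast
qed

subsection \<open>Drawings in the plane\<close>

text \<open>The first two arcs form a Jordan curve with sides \<open>U\<close>, which contains
  \<open>D\<close>, and \<open>V\<close>. The third arc without its ends is attached to
  \<open>D\<close>, so it avoids \<open>V\<close>. A point \<open>v\<close> of \<open>V\<close>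
  reaches \<open>d\<close> in \<open>D\<close> through the second arc, off the other two, and also
  through the first arc. Janiszewski's theorem then joins \<open>v\<close> to \<open>d\<close> off
  all three arcs, although they lie on different sides.\<close>

lemma theta_no_common_side:
  fixes g1 g2 g3 :: "real \<Rightarrow> complex"
  assumes arcs: "arc g1" "arc g2" "arc g3"
    and start: "pathstart g1 = a" "pathstart g2 = a" "pathstart g3 = a"
    and finish: "pathfinish g1 = b" "pathfinish g2 = b" "pathfinish g3 = b"
    and inter: "path_image g1 \<inter> path_image g2 = {a, b}" "path_image g1 \<inter> path_image g3 = {a, b}"
      "path_image g2 \<inter> path_image g3 = {a, b}"
    and D: "connected D" "D \<inter> (path_image g1 \<union> path_image g2 \<union> path_image g3) = {}"
    and x: "x1 \<in> path_image g1 - {a, b}" "x2 \<in> path_image g2 - {a, b}" "x3 \<in> path_image g3 - {a, b}"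
    and cl: "x1 \<in> closure D" "x2 \<in> closure D" "x3 \<in> closure D"
  shows False
proof -
  let ?A1 = "path_image g1" and ?A2 = "path_image g2" and ?A3 = "path_image g3"
  define S where "S = ?A1 \<union> ?A2"
  obtain d where d: "d \<in> D" using cl(1) by force
  have con: "connected (path_image g1 - {a, b})" "connected (path_image g2 - {a, b})"
    "connected (path_image g3 - {a, b})"
    using connected_simple_path_endless arc_imp_simple_path arcs start finish by metis+
  have conD: "connected ((D \<union> {x}) \<union> X)" if "x \<in> X" "x \<in> closure D" "connected X" for x X
  proof (rule connected_Un)
    show "connected (D \<union> {x})"
      by (rule connected_intermediate_closure[OF D(1)]) (use that(2) closure_subset[of D] in auto)
  qed (use that in auto)
  have "simple_path (g1 +++ reversepath g2)"
    by (rule simple_path_join_loop) (use arcs start finish inter in \<open>auto simp: arc_reversepath\<close>)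
  moreover have "path_image (g1 +++ reversepath g2) = S"
    using start finish by (simp add: path_image_join S_def)
  ultimately have J: "inside S \<noteq> {}" "open (inside S)" "connected (inside S)"
    "outside S \<noteq> {}" "open (outside S)" "connected (outside S)"
    "inside S \<inter> outside S = {}" "inside S \<union> outside S = - S"
    "frontier (inside S) = S" "frontier (outside S) = S"
    using Jordan_inside_outside[of "g1 +++ reversepath g2"] start finish by simp_all
  have dS: "d \<in> - S" using d D(2) by (auto simp: S_def)
  \<comment> \<open>The sides are named after the position of \<open>d\<close>, which treats the
    bounded and the unbounded case at once.\<close>
  obtain U V where UV: "open U" "open V" "U \<inter> V = {}" "U \<union> V = - S" "d \<in> U"
    "connected V" "V \<noteq> {}" "frontier V = S"
  proof (cases "d \<in> inside S")
    case True
    then show ?thesis using that[of "inside S" "outside S"] J by blast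
  next
    case False
    then show ?thesis using that[of "outside S" "inside S"] J dS by blast
  qed
  have side: "K \<inter> V = {}" if "connected K" "K \<subseteq> - S" "d \<in> K" for K
    using connectedD[OF that(1) UV(1,2)] UV that by blast
  have "((D \<union> {x3}) \<union> (?A3 - {a, b})) \<inter> V = {}"
    using x cl con d D(2) inter by (intro side conD) (auto simp: S_def)
  then have V3: "?A3 \<inter> V = {}" "D \<inter> V = {}"
    using inter UV(4) by (auto simp: S_def)
  have VS: "S \<subseteq> closure V" "V \<inter> S = {}"
    using UV(4,8) by (auto simp: frontier_def)
  obtain v where v: "v \<in> V" using UV(7) by blast
  \<comment> \<open>The route leads through \<open>V\<close> to its boundary, along the endless arc
    \<open>X\<close> to \<open>x\<close>, and from there into \<open>D\<close>.\<close>
  have cc: "connected_component (- T) v d"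
    if "x \<in> X" "x \<in> closure D" "connected X" "X \<subseteq> S" "X \<inter> T = {}" "T \<inter> V = {}" "T \<inter> D = {}" for x X T
  proof -
    have "connected (V \<union> X)"
      by (rule connected_intermediate_closure[OF UV(6)]) (use that(4) VS closure_subset[of V] in auto)
    then have "connected ((V \<union> X) \<union> ((D \<union> {x}) \<union> X))"
      using conD[OF that(1-3)] that(1) connected_Un by blast
    moreover have "(V \<union> X) \<union> ((D \<union> {x}) \<union> X) \<subseteq> - T"
      using that by auto
    ultimately show ?thesis
      unfolding connected_component_def using v d by (metis UnI1 UnI2)
  qed
  have sub: "?A1 - {a, b} \<subseteq> S" "?A2 - {a, b} \<subseteq> S" by (auto simp: S_def)
  have disj: "(?A1 - {a, b}) \<inter> (?A2 \<union> ?A3) = {}" "(?A2 - {a, b}) \<inter> (?A1 \<union> ?A3) = {}"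
    using inter by blast+
  have dV: "(?A1 \<union> ?A3) \<inter> V = {}" "(?A2 \<union> ?A3) \<inter> V = {}"
    using V3(1) VS(2) unfolding S_def by blast+
  have dD: "(?A1 \<union> ?A3) \<inter> D = {}" "(?A2 \<union> ?A3) \<inter> D = {}"
    using D(2) by blast+
  have "connected_component (- (?A1 \<union> ?A3)) v d"
    by (rule cc[OF x(2) cl(2) con(2) sub(2) disj(2) dV(1) dD(1)])
  moreover have "connected_component (- (?A2 \<union> ?A3)) v d"
    by (rule cc[OF x(1) cl(1) con(1) sub(1) disj(1) dV(2) dD(2)])
  \<comment> \<open>The connected intersection demanded by Janiszewski's theorem is the third
    arc.\<close>
  moreover have "(?A1 \<union> ?A3) \<inter> (?A2 \<union> ?A3) = ?A3" using inter by auto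
  moreover have "compact ?A1" "compact ?A2" "compact ?A3" "connected ?A3"
    using arcs by (auto simp: compact_arc_image connected_arc_image)
  ultimately have "connected_component (- ((?A1 \<union> ?A3) \<union> (?A2 \<union> ?A3))) v d"
    by (metis Janiszewski compact_Un compact_imp_closed)
  then obtain K where "connected K" "K \<subseteq> - ((?A1 \<union> ?A3) \<union> (?A2 \<union> ?A3))" "v \<in> K" "d \<in> K"
    unfolding connected_component_def by blast
  then show False using side[of K] v by (auto simp: S_def)
qed

text \<open>What remains is the image of \<open>{0..<1}\<close>, with the deleted end as a limit.
  Such pieces let a connected set touch a curve without meeting it.\<close>

lemma arc_minus_finish:
  assumes "arc g"
  shows "connected (path_image g - {pathfinish g})" "pathstart g \<in> path_image g - {pathfinish g}"
    "pathfinish g \<in> closure (path_image g - {pathfinish g})"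
proof -
  let ?P = "path_image g - {pathfinish g}"
  have inj: "inj_on g {0..1}" and cont: "continuous_on {0..1} g"
    using assms by (auto simp: arc_def path_def)
  have P: "?P = g ` {0..<1}"
  proof -
    have "{0..1} = insert (1::real) {0..<1}" by auto
    moreover have "g 1 \<notin> g ` {0..<1}" using inj_onD[OF inj, of 1] by force
    ultimately show ?thesis unfolding path_image_def pathfinish_def by auto
  qed
  show "connected ?P" unfolding P
    by (intro connected_continuous_image) (auto intro: continuous_on_subset[OF cont])
  show "pathstart g \<in> ?P" using arc_distinct_ends[OF assms] by auto
  have "g ` closure {0..<1} \<subseteq> closure (g ` {0..<1})"
    by (intro image_closure_subset closure_subset) (auto intro: cont)
  then show "pathfinish g \<in> closure ?P" unfolding P by (auto simp: pathfinish_def)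
qed

section \<open>Paths of a drawn graph and subdivisions of K33\<close>

definition drawn :: "'a pair_pre_digraph \<Rightarrow> ('a set \<Rightarrow> real \<Rightarrow> complex) \<Rightarrow> 'a set \<Rightarrow> complex set" where
  "drawn G c X = (\<Union>(x, y) \<in> parcs G \<inter> X \<times> X. path_image (c {x, y}))"

lemma drawn_mono: "X \<subseteq> Y \<Longrightarrow> drawn G c X \<subseteq> drawn G c Y"
  by (auto simp: drawn_def)

text \<open>Distinct edges meet only in common ends, and a shared edge would have both ends in
  \<open>X \<inter> Y\<close>, where no edge lies.\<close>

lemma drawn_Int:
  assumes "plane_drawing G p c" "parcs G \<inter> (X \<inter> Y) \<times> (X \<inter> Y) = {}"
  shows "drawn G c X \<inter> drawn G c Y \<subseteq> p ` (X \<inter> Y)"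
proof
  fix z assume "z \<in> drawn G c X \<inter> drawn G c Y"
  then obtain x y x' y' where z: "(x, y) \<in> parcs G" "x \<in> X" "y \<in> X" "z \<in> path_image (c {x, y})"
    "(x', y') \<in> parcs G" "x' \<in> Y" "y' \<in> Y" "z \<in> path_image (c {x', y'})"
    unfolding drawn_def by blast
  then have e: "{x, y} \<in> uedges G" "{x', y'} \<in> uedges G" by (auto simp: uedges_def)
  show "z \<in> p ` (X \<inter> Y)"
  proof (cases "{x, y} = {x', y'}")
    case True
    then have "x \<in> X \<inter> Y" "y \<in> X \<inter> Y" using z by (auto simp: doubleton_eq_iff)
    then show ?thesis using assms(2) z by blast
  next
    case False
    have *: "\<forall>e\<in>uedges G. \<forall>f\<in>uedges G. e \<noteq> f \<longrightarrow> path_image (c e) \<inter> path_image (c f) = p ` (e \<inter> f)"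
      using assms(1) by (simp add: plane_drawing_def)
    have "path_image (c {x, y}) \<inter> path_image (c {x', y'}) = p ` ({x, y} \<inter> {x', y'})"
      using *[rule_format, OF e False] .
    then have "z \<in> p ` ({x, y} \<inter> {x', y'})" using z by blast
    moreover have "{x, y} \<inter> {x', y'} \<subseteq> X \<inter> Y" using z by blast
    ultimately show ?thesis by blast
  qed
qed

text \<open>The arcs of the edges are concatenated; the first meets the rest in one point since
  \<open>{x, y}\<close> and \<open>set (y # zs)\<close> share only \<open>y\<close>.\<close>

lemma drawn_path:
  assumes "plane_drawing G p c" "\<And>x. (x, x) \<notin> parcs G"
    and "successively (\<lambda>x y. (x, y) \<in> parcs G) xs" "distinct xs" "2 \<le> length xs"
  shows "\<exists>g. arc g \<and> pathstart g = p (hd xs) \<and> pathfinish g = p (last xs) \<and>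
    p ` set xs \<subseteq> path_image g \<and> path_image g \<subseteq> drawn G c (set xs)"
  using assms(3-5)
proof (induction xs rule: induct_list012)
  case (3 x y zs)
  have xy: "(x, y) \<in> parcs G" using 3 by simp
  then have "{x, y} \<in> uedges G" by (auto simp: uedges_def)
  then have e: "arc (c {x, y})" "{pathstart (c {x, y}), pathfinish (c {x, y})} = {p x, p y}"
    using assms(1) unfolding plane_drawing_def by auto
  \<comment> \<open>An edge is an unordered set, so its curve may run from \<open>y\<close> to
    \<open>x\<close> and then has to be reversed.\<close>
  obtain h where h: "arc h" "pathstart h = p x" "pathfinish h = p y" "path_image h = path_image (c {x, y})"
  proof (cases "pathstart (c {x, y}) = p x")
    case True
    then show ?thesis using that[of "c {x, y}"] e by (auto simp: doubleton_eq_iff)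
  next
    case False
    then show ?thesis using that[of "reversepath (c {x, y})"] e
      by (auto simp: doubleton_eq_iff arc_reversepath)
  qed
  have hd: "path_image h \<subseteq> drawn G c {x, y}"
    using xy h(4) by (auto simp: drawn_def)
  have hp: "p x \<in> path_image h" "p y \<in> path_image h"
    using h pathstart_in_path_image pathfinish_in_path_image by metis+
  show ?case
  proof (cases zs)
    case Nil
    then show ?thesis using h hd hp by (intro exI[of _ h]) auto
  next
    case (Cons z zs')
    then obtain g where g: "arc g" "pathstart g = p y" "pathfinish g = p (last (y # zs))"
      "p ` set (y # zs) \<subseteq> path_image g" "path_image g \<subseteq> drawn G c (set (y # zs))"
      using "3.IH"(2) "3.prems" by auto
    have "{x, y} \<inter> set (y # zs) = {y}" using "3.prems" by auto
    then have "drawn G c {x, y} \<inter> drawn G c (set (y # zs)) \<subseteq> {p y}"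
      using drawn_Int[OF assms(1), of "{x, y}" "set (y # zs)"] assms(2) by auto
    then have "arc (h +++ g)"
      using h g hd by (intro arc_join) auto
    moreover have "path_image (h +++ g) = path_image h \<union> path_image g"
      using h g by (simp add: path_image_join)
    moreover have "drawn G c {x, y} \<subseteq> drawn G c (set (x # y # zs))"
      "drawn G c (set (y # zs)) \<subseteq> drawn G c (set (x # y # zs))"
      by (intro drawn_mono; auto)+
    ultimately show ?thesis
      using h g hd hp by (intro exI[of _ "h +++ g"]) auto
  qed
qed auto

definition graph_path :: "'a pair_pre_digraph \<Rightarrow> 'a list \<Rightarrow> bool" where
  "graph_path G xs \<longleftrightarrow> successively (\<lambda>x y. (x, y) \<in> parcs G) xs \<and> distinct xs \<and>
     2 \<le> length xs \<and> set xs \<subseteq> pverts G"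

text \<open>The branch vertices \<open>a\<close>, \<open>b\<close>, \<open>r\<close> face
  \<open>y1\<close>, \<open>y2\<close>, \<open>y3\<close>. The paths from \<open>a\<close> to
  \<open>b\<close> are drawn as a theta curve, and those from \<open>r\<close> yield a connected set
  touching all three arcs, against \<open>theta_no_common_side\<close>.\<close>

lemma subdivided_K33_not_planar:
  assumes G: "\<And>x. (x, x) \<notin> parcs G" "(a, b) \<notin> parcs G" "(b, a) \<notin> parcs G"
    and X: "graph_path G X1" "hd X1 = a" "last X1 = b" "graph_path G X2" "hd X2 = a" "last X2 = b"
      "graph_path G X3" "hd X3 = a" "last X3 = b"
    and Y: "graph_path G Y1" "hd Y1 = r" "last Y1 = y1" "graph_path G Y2" "hd Y2 = r" "last Y2 = y2"
      "graph_path G Y3" "hd Y3 = r" "last Y3 = y3"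
    and XX: "set X1 \<inter> set X2 = {a, b}" "set X1 \<inter> set X3 = {a, b}" "set X2 \<inter> set X3 = {a, b}"
    and y: "y1 \<in> set X1 - {a, b}" "y2 \<in> set X2 - {a, b}" "y3 \<in> set X3 - {a, b}"
    and YX: "set Y1 \<inter> (set X1 \<union> set X2 \<union> set X3) = {y1}" "set Y2 \<inter> (set X1 \<union> set X2 \<union> set X3) = {y2}"
      "set Y3 \<inter> (set X1 \<union> set X2 \<union> set X3) = {y3}"
  shows "\<not> planar G"
proof
  assume "planar G"
  then obtain p c where pc: "plane_drawing G p c" unfolding planar_def by blast
  have inj: "inj_on p (pverts G)" using pc by (simp add: plane_drawing_def)
  have path: "\<exists>g. arc g \<and> pathstart g = p (hd xs) \<and> pathfinish g = p (last xs) \<and>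
    p ` set xs \<subseteq> path_image g \<and> path_image g \<subseteq> drawn G c (set xs)" if "graph_path G xs" for xs
    using drawn_path[OF pc G(1)] that by (auto simp: graph_path_def)
  obtain f1 where f1: "arc f1" "pathstart f1 = p a" "pathfinish f1 = p b"
    "p ` set X1 \<subseteq> path_image f1" "path_image f1 \<subseteq> drawn G c (set X1)" using path[OF X(1)] X by auto
  obtain f2 where f2: "arc f2" "pathstart f2 = p a" "pathfinish f2 = p b"
    "p ` set X2 \<subseteq> path_image f2" "path_image f2 \<subseteq> drawn G c (set X2)" using path[OF X(4)] X by auto
  obtain f3 where f3: "arc f3" "pathstart f3 = p a" "pathfinish f3 = p b"
    "p ` set X3 \<subseteq> path_image f3" "path_image f3 \<subseteq> drawn G c (set X3)" using path[OF X(7)] X by auto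
  obtain h1 where h1: "arc h1" "pathstart h1 = p r" "pathfinish h1 = p y1"
    "path_image h1 \<subseteq> drawn G c (set Y1)" using path[OF Y(1)] Y by auto
  obtain h2 where h2: "arc h2" "pathstart h2 = p r" "pathfinish h2 = p y2"
    "path_image h2 \<subseteq> drawn G c (set Y2)" using path[OF Y(4)] Y by auto
  obtain h3 where h3: "arc h3" "pathstart h3 = p r" "pathfinish h3 = p y3"
    "path_image h3 \<subseteq> drawn G c (set Y3)" using path[OF Y(7)] Y by auto
  \<comment> \<open>Since \<open>a\<close> and \<open>b\<close> are not adjacent, no edge lies
    within the common vertices, and the drawn paths meet only there.\<close>
  have two: "path_image f \<inter> path_image f' = {p a, p b}"
    if "p ` set X \<subseteq> path_image f" "path_image f \<subseteq> drawn G c (set X)"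
      "p ` set X' \<subseteq> path_image f'" "path_image f' \<subseteq> drawn G c (set X')" "set X \<inter> set X' = {a, b}" for f f' X X'
  proof -
    have "drawn G c (set X) \<inter> drawn G c (set X') \<subseteq> p ` {a, b}"
      using drawn_Int[OF pc, of "set X" "set X'"] G that(5) by auto
    moreover have "a \<in> set X" "b \<in> set X" "a \<in> set X'" "b \<in> set X'" using that(5) by auto
    ultimately show ?thesis using that(1-4) by blast
  qed
  have off: "path_image h \<inter> (path_image f1 \<union> path_image f2 \<union> path_image f3) \<subseteq> {p y}"
    if "path_image h \<subseteq> drawn G c (set Y)" "set Y \<inter> (set X1 \<union> set X2 \<union> set X3) = {y}" for h Y y
  proof -
    have "drawn G c (set Y) \<inter> drawn G c X \<subseteq> p ` {y}" if "set Y \<inter> X \<subseteq> {y}" for X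
    proof -
      have "drawn G c (set Y) \<inter> drawn G c X \<subseteq> p ` (set Y \<inter> X)"
        by (rule drawn_Int[OF pc]) (use G that in auto)
      then show ?thesis using that by blast
    qed
    then have "drawn G c (set Y) \<inter> drawn G c (set X1) \<subseteq> {p y}"
      "drawn G c (set Y) \<inter> drawn G c (set X2) \<subseteq> {p y}"
      "drawn G c (set Y) \<inter> drawn G c (set X3) \<subseteq> {p y}"
      using that(2) by blast+
    then show ?thesis using that(1) f1(5) f2(5) f3(5) by blast
  qed
  \<comment> \<open>The drawn paths from \<open>r\<close> without their last points: connected
    through \<open>p r\<close>, off the theta curve, with \<open>p y1\<close>, \<open>p y2\<close>,
    \<open>p y3\<close> as limits.\<close>
  define D where "D = (path_image h1 - {p y1}) \<union> (path_image h2 - {p y2}) \<union> (path_image h3 - {p y3})"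
  note h1' = arc_minus_finish[OF h1(1), unfolded h1(2,3)]
    and h2' = arc_minus_finish[OF h2(1), unfolded h2(2,3)]
    and h3' = arc_minus_finish[OF h3(1), unfolded h3(2,3)]
  have in_verts: "set X1 \<subseteq> pverts G" "set X2 \<subseteq> pverts G" "set X3 \<subseteq> pverts G" "a \<in> pverts G" "b \<in> pverts G"
    using X XX by (auto simp: graph_path_def)
  have ne: "p z \<notin> {p a, p b}" if "z \<in> pverts G - {a, b}" for z
    using inj that in_verts by (auto dest: inj_onD)
  show False
  proof (rule theta_no_common_side[of f1 f2 f3 "p a" "p b" D "p y1" "p y2" "p y3"])
    show "connected D" unfolding D_def
      using h1' h2' h3' by (intro connected_Un) auto
    show "p y1 \<in> closure D" "p y2 \<in> closure D" "p y3 \<in> closure D"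
      using h1'(3) h2'(3) h3'(3) by (auto simp: D_def closure_Un)
    show "path_image f1 \<inter> path_image f2 = {p a, p b}" "path_image f1 \<inter> path_image f3 = {p a, p b}"
      "path_image f2 \<inter> path_image f3 = {p a, p b}"
      using two[OF f1(4,5) f2(4,5)] two[OF f1(4,5) f3(4,5)] two[OF f2(4,5) f3(4,5)] XX by auto
    show "D \<inter> (path_image f1 \<union> path_image f2 \<union> path_image f3) = {}"
      unfolding D_def using off[OF h1(4) YX(1)] off[OF h2(4) YX(2)] off[OF h3(4) YX(3)] by blast
    show "p y1 \<in> path_image f1 - {p a, p b}" "p y2 \<in> path_image f2 - {p a, p b}"
      "p y3 \<in> path_image f3 - {p a, p b}"
      using ne y in_verts f1(4) f2(4) f3(4) by (auto simp: image_subset_iff subset_iff)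
  qed (use f1 f2 f3 in auto)
qed

section \<open>Straight drawings on the integer lattice\<close>

definition lattice_floor :: "complex \<Rightarrow> complex" where
  "lattice_floor z = Complex (of_int \<lfloor>Re z\<rfloor>) (of_int \<lfloor>Im z\<rfloor>)"

definition lattice_ceiling :: "complex \<Rightarrow> complex" where
  "lattice_ceiling z = Complex (of_int \<lceil>Re z\<rceil>) (of_int \<lceil>Im z\<rceil>)"

text \<open>A point of a unit lattice segment that is not an end determines the segment.\<close>

lemma unit_segment_ends:
  fixes k l :: int
  assumes z: "z \<in> closed_segment (Complex k l) (Complex k' l')"
    and unit: "k' = k + 1 \<and> l' = l \<or> k' = k \<and> l' = l + 1"
  shows "z = Complex k l \<or> z = Complex k' l' \<or>
    lattice_floor z \<noteq> z \<and> lattice_floor z = Complex k l \<and> lattice_ceiling z = Complex k' l'"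
proof -
  obtain u where u: "0 \<le> u" "u \<le> 1" "z = (1 - u) *\<^sub>R Complex k l + u *\<^sub>R Complex k' l'"
    using z by (auto simp: in_segment)
  have zz: "Re z = (1 - u) * k + u * k'" "Im z = (1 - u) * l + u * l'"
    unfolding u(3) by simp_all
  consider "u = 0" | "u = 1" | "0 < u" "u < 1" using u by linarith
  then show ?thesis
  proof cases
    case 3
    show ?thesis
    proof (cases "k' = k + 1 \<and> l' = l")
      case True
      then have re: "Re z = k + u" "Im z = l" using zz by (auto simp: algebra_simps)
      then have "\<lfloor>Re z\<rfloor> = k" "\<lceil>Re z\<rceil> = k + 1" using 3 by linarith+
      then show ?thesis using re True 3 by (auto simp: lattice_floor_def lattice_ceiling_def complex_eq_iff)
    next
      case False
      then have kl: "k' = k" "l' = l + 1" using unit by auto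
      then have re: "Re z = k" "Im z = l + u" using zz by (auto simp: algebra_simps)
      then have "\<lfloor>Im z\<rfloor> = l" "\<lceil>Im z\<rceil> = l + 1" using 3 by linarith+
      then show ?thesis using re kl 3 by (auto simp: lattice_floor_def lattice_ceiling_def complex_eq_iff)
    qed
  qed (use u in auto)
qed

text \<open>Edges become unit segments. Two of them can meet only in lattice points, since at any
  other point floor and ceiling recover both ends and hence the edge.\<close>

lemma planar_if_unit_lattice_edges:
  fixes G :: "'a :: linorder pair_pre_digraph" and k l :: "'a \<Rightarrow> int"
  assumes inj: "inj_on (\<lambda>x. (k x, l x)) (pverts G)" and verts: "parcs G \<subseteq> pverts G \<times> pverts G"
    and unit: "\<And>x y. (x, y) \<in> parcs G \<Longrightarrow> \<bar>k x - k y\<bar> + \<bar>l x - l y\<bar> = 1"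
  shows "planar G"
proof -
  define p where "p x = Complex (k x) (l x)" for x
  \<comment> \<open>An edge comes as an unordered set; the linear order of the vertices selects a
    direction.\<close>
  define c where "c e = linepath (p (Min e)) (p (Max e))" for e
  have pinj: "inj_on p (pverts G)"
    using inj by (auto simp: inj_on_def p_def)
  have lat: "lattice_floor (p x) = p x" for x
    by (simp add: p_def lattice_floor_def)
  have edge: "\<exists>x y. e = {x, y} \<and> x \<in> pverts G \<and> y \<in> pverts G \<and> p x \<noteq> p y \<and>
      {pathstart (c e), pathfinish (c e)} = {p x, p y} \<and> arc (c e) \<and>
      (\<forall>z\<in>path_image (c e). z = p x \<or> z = p y \<or> lattice_floor z \<noteq> z \<and> {p x, p y} = {lattice_floor z, lattice_ceiling z})"
    if e: "e \<in> uedges G" for e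
  proof -
    obtain x0 y0 where xy0: "e = {x0, y0}" "(x0, y0) \<in> parcs G"
      using e unfolding uedges_def by blast
    have u0: "\<bar>k x0 - k y0\<bar> + \<bar>l x0 - l y0\<bar> = 1" using unit xy0 by blast
    \<comment> \<open>Up to exchanging the ends, the segment goes one unit right or up, as
      \<open>unit_segment_ends\<close> requires.\<close>
    then have "k y0 = k x0 + 1 \<and> l y0 = l x0 \<or> k y0 = k x0 \<and> l y0 = l x0 + 1 \<or>
        k x0 = k y0 + 1 \<and> l x0 = l y0 \<or> k x0 = k y0 \<and> l x0 = l y0 + 1" by linarith
    then obtain x y where xy: "e = {x, y}" "x \<in> pverts G" "y \<in> pverts G"
      "k y = k x + 1 \<and> l y = l x \<or> k y = k x \<and> l y = l x + 1"
      using xy0 verts by (metis insert_commute mem_Sigma_iff subsetD)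
    then have ne: "p x \<noteq> p y" by (auto simp: p_def)
    have "c e = linepath (p x) (p y) \<or> c e = linepath (p y) (p x)"
      by (cases "x \<le> y") (auto simp: c_def xy(1) min_def max_def)
    then have ce: "{pathstart (c e), pathfinish (c e)} = {p x, p y}" "arc (c e)"
      "path_image (c e) = closed_segment (p x) (p y)"
      using ne by (auto simp: closed_segment_commute)
    have "z = p x \<or> z = p y \<or> lattice_floor z \<noteq> z \<and> {p x, p y} = {lattice_floor z, lattice_ceiling z}"
      if "z \<in> path_image (c e)" for z
      using unit_segment_ends[of z "k x" "l x" "k y" "l y"] that xy(4) unfolding ce(3) p_def by auto
    then show ?thesis using xy ne ce by blast
  qed
  have pe: "p ` e \<subseteq> path_image (c e)" if "e \<in> uedges G" for e
  proof -
    have "p ` e = {pathstart (c e), pathfinish (c e)}" using edge[OF that] by auto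
    then show ?thesis by auto
  qed
  have ev: "e \<subseteq> pverts G" if "e \<in> uedges G" for e using edge[OF that] by auto
  have pt: "z \<in> p ` e \<or> lattice_floor z \<noteq> z \<and> p ` e = {lattice_floor z, lattice_ceiling z}"
    if "e \<in> uedges G" "z \<in> path_image (c e)" for e z
    using edge[OF that(1)] that(2) by auto
  have "plane_drawing G p c"
    unfolding plane_drawing_def
  proof (intro conjI ballI impI pinj)
    fix e assume e: "e \<in> uedges G"
    show "arc (c e)" "{pathstart (c e), pathfinish (c e)} = p ` e" using edge[OF e] by auto
    show "path_image (c e) \<inter> p ` pverts G = p ` e"
      using pe[OF e] ev[OF e] pt[OF e] lat by fastforce
  next
    fix e f assume e: "e \<in> uedges G" and f: "f \<in> uedges G" and "e \<noteq> f"
    show "path_image (c e) \<inter> path_image (c f) = p ` (e \<inter> f)"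
    proof (intro equalityI subsetI)
      fix z assume z: "z \<in> path_image (c e) \<inter> path_image (c f)"
      have "z \<in> p ` e \<and> z \<in> p ` f"
      proof (cases "lattice_floor z = z")
        case True
        then show ?thesis using pt e f z by blast
      next
        case False
        then have "z \<notin> p ` e" "z \<notin> p ` f" using lat by auto
        then have "p ` e = p ` f" using pt[OF e, of z] pt[OF f, of z] z by simp
        then have "e = f" using inj_on_image_eq_iff[OF pinj ev[OF e] ev[OF f]] by blast
        then show ?thesis using \<open>e \<noteq> f\<close> by blast
      qed
      then show "z \<in> p ` (e \<inter> f)"
        using inj_on_image_Int[OF pinj ev[OF e] ev[OF f]] by blast
    next
      fix z assume "z \<in> p ` (e \<inter> f)"
      then show "z \<in> path_image (c e) \<inter> path_image (c f)" using pe[OF e] pe[OF f] by auto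
    qed
  qed
  then show ?thesis unfolding planar_def by blast
qed

subsection \<open>Planarity of framed ladders\<close>

text \<open>The track on which the lane starting at track \<open>i\<close> passes column
  \<open>q\<close>. The leading \<open>id\<close> belongs to the left bounding letter, so column
  \<open>q\<close> is reached after \<open>q\<close> letters.\<close>

definition lane :: "(nat \<Rightarrow> nat) list \<Rightarrow> nat \<Rightarrow> nat \<Rightarrow> nat" where
  "lane u q i = track (take q (id # u)) i"

lemma div_mod_5: "i < 5 \<Longrightarrow> (5 * q + i) div 5 = q" "i < 5 \<Longrightarrow> (5 * q + i) mod 5 = i" for i q :: nat
  by auto

lemma lane_0: "lane u 0 i = i"
  by (simp add: lane_def)

lemma lane_Suc: "q < Suc (length u) \<Longrightarrow> lane u (Suc q) i = ((id # u) ! q) (lane u q i)"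
  by (simp add: lane_def take_Suc_conv_app_nth track_append del: take_Suc_Cons)

lemma lane_last: "lane u (Suc (length u)) i = track u i"
  by (simp add: lane_def)

lemma three_cycle_lt: "three_cycle s \<Longrightarrow> i < 5 \<Longrightarrow> s i < 5"
  unfolding three_cycle_def cyc_def by auto

lemma inj_three_cycle: "three_cycle s \<Longrightarrow> s i = s j \<Longrightarrow> i = j"
  by (metis three_cycle_cube)

lemma track_lt: "set u \<subseteq> Collect three_cycle \<Longrightarrow> i < 5 \<Longrightarrow> track u i < 5"
  by (induction u arbitrary: i) (auto simp: three_cycle_lt)

lemma track_inj: "set u \<subseteq> Collect three_cycle \<Longrightarrow> track u i = track u j \<Longrightarrow> i = j"
  by (induction u arbitrary: i j) (auto dest: inj_three_cycle)

lemma set_take_three_cycles: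
  "set u \<subseteq> Collect three_cycle \<Longrightarrow> set (take q u) \<subseteq> Collect three_cycle"
  using set_take_subset by fastforce

lemma lane_lt: "set u \<subseteq> Collect three_cycle \<Longrightarrow> i < 5 \<Longrightarrow> lane u q i < 5"
  by (cases q) (auto simp: lane_def intro!: track_lt set_take_three_cycles)

lemma lane_inj: "set u \<subseteq> Collect three_cycle \<Longrightarrow> lane u q i = lane u q j \<Longrightarrow> i = j"
  by (cases q) (auto simp: lane_def dest!: track_inj[OF set_take_three_cycles])

lemma lane_surj:
  assumes u: "set u \<subseteq> Collect three_cycle" and "j < 5"
  shows "\<exists>i<5. lane u q i = j"
proof -
  have "lane u q ` {..<5} = {..<5}"
    by (rule endo_inj_surj) (use lane_lt[OF u] lane_inj[OF u] in \<open>auto simp: inj_on_def\<close>)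
  then show ?thesis using \<open>j < 5\<close> by (metis imageE lessThan_iff)
qed

lemma length_framed: "length (framed u) = Suc (Suc (length u))"
  by (simp add: framed_def)

lemma snd_framed: "q < Suc (length u) \<Longrightarrow> snd (framed u ! q) = (id # u) ! q"
  by (cases q) (auto simp: framed_def nth_append)

lemma fst_framed: "q < Suc (Suc (length u)) \<Longrightarrow> fst (framed u ! q) \<longleftrightarrow> q = 0 \<or> q = Suc (length u)"
  by (cases q) (auto simp: framed_def nth_append)

lemma ladder_step_framed_cases:
  assumes "ladder_step (framed u) a b"
  obtains (column) "a div 5 = b div 5" "a div 5 = 0 \<or> a div 5 = Suc (length u)" "b mod 5 = Suc (a mod 5)"
  | (lane) "b div 5 = Suc (a div 5)" "a div 5 < Suc (length u)" "b mod 5 = ((id # u) ! (a div 5)) (a mod 5)"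
proof -
  have lt: "a div 5 < Suc (Suc (length u))" "b div 5 < Suc (Suc (length u))"
    using assms by (auto simp: ladder_step_def length_framed)
  show thesis
  proof (cases "a div 5 = b div 5")
    case True
    then show ?thesis
      using assms lt fst_framed[of "a div 5" u] by (intro column) (auto simp: ladder_step_def)
  next
    case False
    then have b: "b div 5 = Suc (a div 5)" using assms by (auto simp: ladder_step_def)
    then show ?thesis
      using assms lt snd_framed[of "a div 5" u] by (intro lane) (auto simp: ladder_step_def)
  qed
qed

text \<open>A vertex is placed at its column number and at the height \<open>l a\<close>, the
  starting track of its lane. Lanes become horizontal; the paths in the outer columns become
  vertical because lanes are back on their starting tracks in the last column.\<close>

lemma ladder_framed_planar:
  assumes u: "set u \<subseteq> Collect three_cycle" and t: "track u = id"
  shows "planar (ladder (framed u))"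
proof -
  define l where "l a = (THE i. i < 5 \<and> lane u (a div 5) i = a mod 5)" for a
  have ex1: "\<exists>!i. i < 5 \<and> lane u (a div 5) i = a mod 5" for a
    using lane_surj[OF u, of "a mod 5" "a div 5"] lane_inj[OF u] by (metis mod_less_divisor zero_less_numeral)
  have l: "l a < 5" "lane u (a div 5) (l a) = a mod 5" for a
    using theI'[OF ex1[of a]] by (auto simp: l_def)
  have step: "\<bar>int (a div 5) - int (b div 5)\<bar> + \<bar>int (l a) - int (l b)\<bar> = 1"
    if "ladder_step (framed u) a b" for a b
    using that
  proof (cases rule: ladder_step_framed_cases)
    case column
    then have "lane u (a div 5) i = i" for i
      using t by (auto simp: lane_0 lane_last)
    then have "l a = a mod 5" "l b = b mod 5" using l[of a] l[of b] column by auto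
    then show ?thesis using column by auto
  next
    case lane
    have "lane u (b div 5) (l a) = ((id # u) ! (a div 5)) (a mod 5)"
      using lane_Suc[OF lane(2)] lane(1) l(2)[of a] by simp
    then have "lane u (b div 5) (l a) = lane u (b div 5) (l b)" using lane(3) l(2)[of b] by simp
    then have "l a = l b" by (rule lane_inj[OF u])
    then show ?thesis using lane by simp
  qed
  show ?thesis
  proof (rule planar_if_unit_lattice_edges[of "\<lambda>a. int (a div 5)" "\<lambda>a. int (l a)"])
    have inj: "a = b" if "a div 5 = b div 5" "l a = l b" for a b
    proof -
      have "a mod 5 = b mod 5" using l(2)[of a] l(2)[of b] that by simp
      then show ?thesis using that(1) by (metis div_mult_mod_eq)
    qed
    show "inj_on (\<lambda>a. (int (a div 5), int (l a))) (pverts (ladder (framed u)))"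
      by (rule inj_onI, rule inj) simp_all
    show "parcs (ladder (framed u)) \<subseteq> pverts (ladder (framed u)) \<times> pverts (ladder (framed u))"
      by (auto simp: ladder_def ladder_step_def)
    fix a b assume "(a, b) \<in> parcs (ladder (framed u))"
    then have "ladder_step (framed u) a b \<or> ladder_step (framed u) b a" by (simp add: ladder_def)
    then show "\<bar>int (a div 5) - int (b div 5)\<bar> + \<bar>int (l a) - int (l b)\<bar> = 1"
      using step[of a b] step[of b a] by (auto simp: abs_minus_commute)
  qed
qed

section \<open>A subdivided K33 in ladders with product a three-cycle\<close>

lemma successively_upt:
  "(\<And>q. Suc q < n \<Longrightarrow> P q (Suc q)) \<Longrightarrow> successively P [0..<n]"
proof (induction n)
  case (Suc n)
  then show ?case by (cases n) (auto simp: successively_append_iff)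
qed simp

definition lane_path :: "(nat \<Rightarrow> nat) list \<Rightarrow> nat \<Rightarrow> nat list" where
  "lane_path u i = map (\<lambda>q. 5 * q + lane u q i) [0..<Suc (Suc (length u))]"

lemma hd_lane_path: "hd (lane_path u i) = i"
  by (simp add: lane_path_def hd_map lane_0 del: upt_Suc)

lemma last_lane_path: "last (lane_path u i) = 5 * Suc (length u) + track u i"
  by (simp add: lane_path_def last_map lane_last)

lemma lane_path_not_Nil: "lane_path u i \<noteq> []"
  by (simp add: lane_path_def)

lemma in_lane_path:
  assumes u: "set u \<subseteq> Collect three_cycle" and i: "i < 5"
  shows "a \<in> set (lane_path u i) \<longleftrightarrow> a div 5 < Suc (Suc (length u)) \<and> lane u (a div 5) i = a mod 5"
proof -
  have "a = 5 * q + lane u q i \<longleftrightarrow> q = a div 5 \<and> lane u q i = a mod 5" for q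
    using lane_lt[OF u i, of q] by auto
  moreover have "a \<in> set (lane_path u i) \<longleftrightarrow> (\<exists>q. q < Suc (Suc (length u)) \<and> a = 5 * q + lane u q i)"
    by (simp only: lane_path_def set_map set_upt image_iff atLeastLessThan_iff Bex_def) simp
  ultimately show ?thesis by (simp only:) blast
qed

lemma graph_path_lane_path:
  assumes u: "set u \<subseteq> Collect three_cycle" and i: "i < 5"
  shows "graph_path (ladder (framed u)) (lane_path u i)"
proof -
  have lt: "lane u q i < 5" for q using lane_lt[OF u i] .
  have "ladder_step (framed u) (5 * q + lane u q i) (5 * Suc q + lane u (Suc q) i)"
    if "Suc q < Suc (Suc (length u))" for q
  proof -
    have "(5 * q + lane u q i) div 5 = q" "(5 * q + lane u q i) mod 5 = lane u q i"
      "(5 * Suc q + lane u (Suc q) i) div 5 = Suc q" "(5 * Suc q + lane u (Suc q) i) mod 5 = lane u (Suc q) i"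
      by (rule div_mod_5, rule lt)+
    moreover have "5 * q + lane u q i < 5 * length (framed u)" "5 * Suc q + lane u (Suc q) i < 5 * length (framed u)"
      using that lt[of q] lt[of "Suc q"] by (auto simp: length_framed)
    ultimately show ?thesis
      using snd_framed[of q u] lane_Suc[of q u i] that unfolding ladder_step_def by simp
  qed
  then have "successively (\<lambda>x y. (x, y) \<in> parcs (ladder (framed u))) (lane_path u i)"
    unfolding lane_path_def successively_map by (intro successively_upt) (auto simp: ladder_def)
  moreover have "inj (\<lambda>q. 5 * q + lane u q i)"
    by (rule injI) (metis div_mod_5(1) lt)
  then have "distinct (lane_path u i)"
    unfolding lane_path_def distinct_map using distinct_upt inj_on_subset by blast
  moreover have "5 * q + lane u q i < 5 * length (framed u)" if "q < Suc (Suc (length u))" for q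
    using that lt[of q] by (auto simp: length_framed)
  then have "set (lane_path u i) \<subseteq> pverts (ladder (framed u))"
    by (auto simp: lane_path_def ladder_def simp del: upt_Suc)
  ultimately show ?thesis by (auto simp: graph_path_def lane_path_def)
qed

text \<open>The lanes arrive in the last column in the order 0, 4, 2, 1, 3, and the paths in the two
  outer columns link them to a subdivided K33.\<close>

lemma ladder_framed_not_planar:
  assumes u: "set u \<subseteq> Collect three_cycle" and t: "track u = cyc 1 3 4"
  shows "\<not> planar (ladder (framed u))"
proof -
  let ?G = "ladder (framed u)" and ?T = "lane_path u"
  \<comment> \<open>The vertex on track 0 of the last column.\<close>
  define N where "N = 5 * Suc (length u)"
  have N: "N \<ge> 5" by (simp add: N_def)
  have T: "successively (\<lambda>x y. (x, y) \<in> parcs ?G) (?T i)" "distinct (?T i)" "set (?T i) \<subseteq> pverts ?G"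
    if "i < 5" for i using graph_path_lane_path[OF u that] by (auto simp: graph_path_def)
  have sym: "(x, y) \<in> parcs ?G \<longleftrightarrow> (y, x) \<in> parcs ?G" for x y by (auto simp: ladder_def)
  have Trev: "successively (\<lambda>x y. (x, y) \<in> parcs ?G) (rev (?T i))" if "i < 5" for i
    using T(1)[OF that] by (simp add: sym)
  have lastT: "last (?T 0) = N" "last (?T 1) = N + 3" "last (?T 2) = N + 2" "last (?T 3) = N + 4" "last (?T 4) = N + 1"
    unfolding last_lane_path t N_def by (simp_all add: cyc_def)
  have disj: "set (?T i) \<inter> set (?T j) = {}" if "i < 5" "j < 5" "i \<noteq> j" for i j
    using that in_lane_path[OF u] lane_inj[OF u] by (metis disjoint_iff)
  have inL: "x \<in> set (?T i) \<longleftrightarrow> x = i" if "x < 5" "i < 5" for x i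
    using in_lane_path[OF u that(2), of x] that by (auto simp: lane_0)
  have inR: "N + m \<in> set (?T i) \<longleftrightarrow> m = cyc 1 3 4 i" if "m < 5" "i < 5" for m i
  proof -
    have "(N + m) div 5 = Suc (length u)" "(N + m) mod 5 = m" unfolding N_def by (rule div_mod_5, rule that(1))+
    then show ?thesis using in_lane_path[OF u that(2), of "N + m"] by (auto simp: lane_last t)
  qed
  have edgeL: "(i, j) \<in> parcs ?G" "(j, i) \<in> parcs ?G" if "j = Suc i" "i < 4" for i j
    using that fst_framed[of 0 u] by (auto simp: ladder_def ladder_step_def length_framed)
  have edgeR: "(N + i, N + j) \<in> parcs ?G" "(N + j, N + i) \<in> parcs ?G" if j: "j = Suc i" and "i < 4" for i j
  proof -
    have "(N + i) div 5 = Suc (length u)" "(N + i) mod 5 = i" "(N + Suc i) div 5 = Suc (length u)"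
      "(N + Suc i) mod 5 = Suc i"
      unfolding N_def using \<open>i < 4\<close> by (simp_all only: div_mod_5)
    moreover have "N + Suc i < 5 * length (framed u)"
      using \<open>i < 4\<close> by (simp add: N_def length_framed)
    ultimately have "ladder_step (framed u) (N + i) (N + Suc i)"
      using fst_framed[of "Suc (length u)" u] unfolding ladder_step_def by simp
    then show "(N + i, N + j) \<in> parcs ?G" "(N + j, N + i) \<in> parcs ?G" by (auto simp: ladder_def j)
  qed
  have verts: "a \<in> pverts ?G \<longleftrightarrow> a < N + 5" for a by (simp add: ladder_def length_framed N_def)
  have e: "(0, 1) \<in> parcs ?G" "(1, 0) \<in> parcs ?G" "(1, 2) \<in> parcs ?G" "(2, 3) \<in> parcs ?G" "(4, 3) \<in> parcs ?G"
    by (rule edgeL; simp)+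
  have e': "(N + 0, N + 1) \<in> parcs ?G" "(N + 2, N + 1) \<in> parcs ?G" "(N + 2, N + 3) \<in> parcs ?G" "(N + 3, N + 4) \<in> parcs ?G"
    by (rule edgeR; simp)+
  note e = e e'[unfolded add_0_right]
  \<comment> \<open>Keeps 1 and \<open>N + 2\<close> from turning into successors, so that the facts
    about numerals still match.\<close>
  note [simp del] = One_nat_def add_2_eq_Suc add_2_eq_Suc'
  note mem = inL inR cyc_def
  have len: "length (?T i) = Suc (Suc (length u))" for i by (simp add: lane_path_def)
  have d: "set (?T 0) \<inter> set (?T 4) = {}" "set (?T 1) \<inter> set (?T 3) = {}"
    "set (?T 0) \<inter> set (?T 1) = {}" "set (?T 0) \<inter> set (?T 3) = {}" "set (?T 4) \<inter> set (?T 1) = {}"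
    "set (?T 4) \<inter> set (?T 3) = {}" "set (?T 2) \<inter> set (?T 0) = {}" "set (?T 2) \<inter> set (?T 1) = {}"
    "set (?T 2) \<inter> set (?T 3) = {}" "set (?T 2) \<inter> set (?T 4) = {}"
    by (rule disj; simp)+
  note path_simps = successively_append_iff successively_Cons hd_lane_path hd_rev last_rev lastT
    lane_path_not_Nil len verts T(1,2) Trev
  \<comment> \<open>Branch vertices are 1, 3, \<open>N + 2\<close> against 2, \<open>N + 1\<close>,
    \<open>N + 3\<close>. The paths from 1 to 3 use the first column, lanes 0 and 4, and lanes 1 and
    3; those from \<open>N + 2\<close> use lane 2 and two edges of the last column.\<close>
  show ?thesis
  proof (rule subdivided_K33_not_planar[where a = 1 and b = 3 and r = "N + 2"
        and ?X1.0 = "[1, 2, 3]" and ?X2.0 = "1 # ?T 0 @ rev (?T 4) @ [3]" and ?X3.0 = "?T 1 @ rev (?T 3)"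
        and ?Y1.0 = "rev (?T 2)" and ?Y2.0 = "[N + 2, N + 1]" and ?Y3.0 = "[N + 2, N + 3]"
        and ?y1.0 = 2 and ?y2.0 = "N + 1" and ?y3.0 = "N + 3"])
    show "(x, x) \<notin> parcs ?G" for x by (auto simp: ladder_def ladder_step_def)
    show "(1, 3) \<notin> parcs ?G" "(3, 1) \<notin> parcs ?G" by (auto simp: ladder_def ladder_step_def)
    show "graph_path ?G [1, 2, 3]" using e N by (auto simp: graph_path_def verts)
    show "graph_path ?G [N + 2, N + 1]" "graph_path ?G [N + 2, N + 3]"
      using e by (auto simp: graph_path_def verts)
    show "graph_path ?G (rev (?T 2))" using T[of 2] Trev[of 2] by (auto simp: graph_path_def len)
    have "successively (\<lambda>x y. (x, y) \<in> parcs ?G) (?T 1 @ rev (?T 3))"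
      unfolding path_simps(1) using T(1)[of 1] Trev[of 3] e by (simp add: path_simps)
    then show "graph_path ?G (?T 1 @ rev (?T 3))"
      using T[of 1] T[of 3] d by (auto simp: graph_path_def len)
    have "successively (\<lambda>x y. (x, y) \<in> parcs ?G) (1 # ?T 0 @ rev (?T 4) @ [3])"
      using T(1)[of 0] Trev[of 4] e by (simp add: path_simps)
    then show "graph_path ?G (1 # ?T 0 @ rev (?T 4) @ [3])"
      using T[of 0] T[of 4] d N by (auto simp: graph_path_def len mem verts)
    show "hd (1 # ?T 0 @ rev (?T 4) @ [3]) = 1" "last (1 # ?T 0 @ rev (?T 4) @ [3]) = 3"
      "hd [1, 2, 3] = (1::nat)" "last [1, 2, 3] = (3::nat)"
      "hd [N + 2, N + 1] = N + 2" "last [N + 2, N + 1] = N + 1"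
      "hd [N + 2, N + 3] = N + 2" "last [N + 2, N + 3] = N + 3" by simp_all
    show "hd (?T 1 @ rev (?T 3)) = 1" "last (?T 1 @ rev (?T 3)) = 3"
      "hd (rev (?T 2)) = N + 2" "last (rev (?T 2)) = 2"
      by (simp_all add: path_simps)
    show "set [1, 2, 3] \<inter> set (1 # ?T 0 @ rev (?T 4) @ [3]) = {1, 3}"
      "set [1, 2, 3] \<inter> set (?T 1 @ rev (?T 3)) = {1, 3}"
      by (auto simp: mem)
    have "1 \<in> set (?T 1)" "3 \<in> set (?T 3)" by (simp_all add: mem)
    then show "set (1 # ?T 0 @ rev (?T 4) @ [3]) \<inter> set (?T 1 @ rev (?T 3)) = {1, 3}"
      using d by auto
    show "2 \<in> set [1, 2, 3] - {1, 3::nat}" by simp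
    show "N + 1 \<in> set (1 # ?T 0 @ rev (?T 4) @ [3]) - {1, 3}" "N + 3 \<in> set (?T 1 @ rev (?T 3)) - {1, 3}"
      using N by (auto simp: mem)
    have "2 \<in> set (?T 2)" "1 \<notin> set (?T 2)" "3 \<notin> set (?T 2)" by (simp_all add: mem)
    then show "set (rev (?T 2)) \<inter> (set [1, 2, 3] \<union> set (1 # ?T 0 @ rev (?T 4) @ [3]) \<union> set (?T 1 @ rev (?T 3))) = {2}"
      using d by auto
    show "set [N + 2, N + 1] \<inter> (set [1, 2, 3] \<union> set (1 # ?T 0 @ rev (?T 4) @ [3]) \<union> set (?T 1 @ rev (?T 3))) = {N + 1}"
      "set [N + 2, N + 3] \<inter> (set [1, 2, 3] \<union> set (1 # ?T 0 @ rev (?T 4) @ [3]) \<union> set (?T 1 @ rev (?T 3))) = {N + 3}"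
      using N by (auto simp: mem)
  qed
qed

theorem theorem6p4:
  shows "\<not> cfol_definable_on_ordered_graphs planar_graphs"
proof (rule not_definable_if_separates_tracks)
  show "three_cycle (cyc 1 3 4)"
    unfolding three_cycle_def by (intro exI[of _ 1] exI[of _ 3] exI[of _ 4]) auto
next
  fix u assume "set u \<subseteq> Collect three_cycle" "track u = cyc 1 3 4"
  then show "ladder (framed u) \<notin> planar_graphs"
    using ladder_framed_not_planar by (auto simp: planar_graphs_def)
next
  fix u assume "set u \<subseteq> Collect three_cycle" "track u = id"
  then show "ladder (framed u) \<in> planar_graphs"
    using ladder_framed_planar pair_graph_ladder by (auto simp: planar_graphs_def)
qed

end
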